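(* Let $K:\mathbb R\to\mathbb R$ be bounded, square integrable, with $\int_{\mathbb R}K(y)\,dy=1$, and let the density $f$ be bounded. Assume that there exists $\mathfrak m>0$, not depending on $n$, such that $$\frac1n\sum_{i=1}^{N(n)}\frac1{h_i}\leqslant\mathfrak m ,$$ and that for every $c>0$ there exists $\mathfrak m(c)>0$, not depending on $n$, such that $$\sum_{i=1}^{N(n)}\frac1{\sqrt{h_i}}\exp\left(-\frac{c}{\sqrt{h_i}}\right)\leqslant\mathfrak m(c).$$ If $\mathbb E(Y_1^6)<\infty$, then there exist two deterministic constants $\mathfrak c,\overline{\mathfrak c}>0$, not depending on $n$, such that $$\mathbb E\left(\|\widehat{bf}_{n,\widehat h_n}-bf\|_2^2\right)\leqslant\mathfrak c\cdot\inf_{h\in\mathcal H_n}\left\{\|(bf)_h-bf\|_2^2+V_n(h)\right\}+\overline{\mathfrak c}\,\frac{\log(n)^2}{n}.$$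
   Context: Model: $X_1,\dots,X_n$ are independent real random variables with common probability density $f$ with respect to Lebesgue measure, $b:\mathbb R\to\mathbb R$ is measurable, and $Y_i=b(X_i)+\varepsilon_i$, where $\varepsilon_1,\dots,\varepsilon_n$ are i.i.d. centered random variables with variance $\sigma^2>0$, independent of $X_1,\dots,X_n$. $bf$ denotes the product of the functions $b$ and $f$. Notation: $\|\cdot\|_p$ is the norm of $L^p(\mathbb R,dx)$, $\ast$ is convolution on $\mathbb R$, $x_+=\max(x,0)$, $K_h:=\frac1hK(\cdot/h)$, and $(bf)_h:=K_h\ast(bf)$. Bandwidths: $\mathcal H_n=\{h_1,\dots,h_{N(n)}\}\subset[0,1]$ is a collection of bandwidths with $N(n)\in\{1,\dots,n\}$ and $\frac1n<h_1<\dots<h_{N(n)}$. Estimators: for $h,\eta>0$ and $x\in\mathbb R$, $$\widehat{bf}_{n,h}(x):=\frac1{nh}\sum_{i=1}^nK\left(\frac{X_i-x}{h}\right)Y_i,\qquad \widehat{bf}_{n,h,\eta}(x):=(K_\eta\ast\widehat{bf}_{n,h})(x).$$ Goldenshluger-Lepski selection: with $\mathfrak c_{K,Y}:=\|K\|_2^2\,\mathbb E(Y_1^2)$ and a constant $\upsilon>0$ not depending on $n$ and $h$, $$V_n(h):=\upsilon\,\frac{\mathfrak c_{K,Y}}{nh}\|K\|_1^2,\qquad A_n(h):=\sup_{\eta\in\mathcal H_n}\left(\|\widehat{bf}_{n,h,\eta}-\widehat{bf}_{n,\eta}\|_2^2-V_n(\eta)\right)_+,$$ and $\widehat h_n$ denotes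 the solution of the minimization problem $\min_{h\in\mathcal H_n}\{A_n(h)+V_n(h)\}$.
   Formalization: K is additionally assumed even (K(-x)=K(x)): the estimator uses K((X_i-x)/h) but (bf)_h=K_h*(bf), and the bound fails for shifted kernels. The constant υ is taken at least a universal υ_0, since the bound fails for small υ. *)

theory Defs
  imports "HOL-Probability.Probability"
begin

definition Lp_norm :: "real \<Rightarrow> (real \<Rightarrow> real) \<Rightarrow> real" where
  "Lp_norm p g = (\<integral>x. \<bar>g x\<bar> powr p \<partial>lborel) powr (1 / p)"

definition fconv :: "(real \<Rightarrow> real) \<Rightarrow> (real \<Rightarrow> real) \<Rightarrow> real \<Rightarrow> real" where
  "fconv g k x = (\<integral>y. g (x - y) * k y \<partial>lborel)"

definition scaled :: "(real \<Rightarrow> real) \<Rightarrow> real \<Rightarrow> real \<Rightarrow> real" where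
  "scaled K h x = 1 / h * K (x / h)"

text \<open>The observations are indexed from 1. The samples of all sizes \<open>n\<close> are the first \<open>n\<close>
  members of one sequence, so that constants can be required not to depend on \<open>n\<close>.\<close>

locale regression_model = prob_space M for M :: "'a measure" +
  fixes X \<epsilon> :: "nat \<Rightarrow> 'a \<Rightarrow> real"
    and b f :: "real \<Rightarrow> real"
    and \<sigma> :: real
  assumes f_measurable: "f \<in> borel_measurable borel"
    and f_nonneg: "\<And>x. 0 \<le> f x"
    and b_measurable: "b \<in> borel_measurable borel"
    and X_density: "\<And>i. 1 \<le> i \<Longrightarrow> distributed M lborel (X i) (\<lambda>x. ennreal (f x))"
    and X_indep: "indep_vars (\<lambda>_. borel) X {1..}"
    and eps_indep: "indep_vars (\<lambda>_. borel) \<epsilon> {1..}"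
    and eps_identical: "\<And>i. 1 \<le> i \<Longrightarrow> distr M borel (\<epsilon> i) = distr M borel (\<epsilon> 1)"
    and eps_integrable: "integrable M (\<epsilon> 1)" "integrable M (\<lambda>\<omega>. (\<epsilon> 1 \<omega>)\<^sup>2)"
    and eps_centered: "expectation (\<epsilon> 1) = 0"
    and eps_variance: "variance (\<epsilon> 1) = \<sigma>\<^sup>2"
    and sigma_pos: "0 < \<sigma>\<^sup>2"
    and X_eps_indep: "indep_var
        (PiM {1..} (\<lambda>_. borel)) (\<lambda>\<omega>. \<lambda>i\<in>{1..}. X i \<omega>)
        (PiM {1..} (\<lambda>_. borel)) (\<lambda>\<omega>. \<lambda>i\<in>{1..}. \<epsilon> i \<omega>)"

definition response :: "(real \<Rightarrow> real) \<Rightarrow> (nat \<Rightarrow> 'a \<Rightarrow> real) \<Rightarrow> (nat \<Rightarrow> 'a \<Rightarrow> real)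
    \<Rightarrow> nat \<Rightarrow> 'a \<Rightarrow> real" where
  "response b X \<epsilon> i \<omega> = b (X i \<omega>) + \<epsilon> i \<omega>"

text \<open>The kernel is evaluated at \<open>(X\<^sub>i - x) / h\<close>, so the mean of \<open>bf_hat\<close> is the convolution
  \<open>fconv (scaled K h) (\<lambda>x. b x * f x)\<close> only if \<open>K\<close> is even.\<close>

definition bf_hat :: "(real \<Rightarrow> real) \<Rightarrow> (nat \<Rightarrow> 'a \<Rightarrow> real) \<Rightarrow> (nat \<Rightarrow> 'a \<Rightarrow> real)
    \<Rightarrow> nat \<Rightarrow> real \<Rightarrow> 'a \<Rightarrow> real \<Rightarrow> real" where
  "bf_hat K X Y n h \<omega> x =
     1 / (real n * h) * (\<Sum>i=1..n. K ((X i \<omega> - x) / h) * Y i \<omega>)"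

definition bf_hat2 :: "(real \<Rightarrow> real) \<Rightarrow> (nat \<Rightarrow> 'a \<Rightarrow> real) \<Rightarrow> (nat \<Rightarrow> 'a \<Rightarrow> real)
    \<Rightarrow> nat \<Rightarrow> real \<Rightarrow> real \<Rightarrow> 'a \<Rightarrow> real \<Rightarrow> real" where
  "bf_hat2 K X Y n h \<eta> \<omega> = fconv (scaled K \<eta>) (bf_hat K X Y n h \<omega>)"

definition bandwidths :: "nat \<Rightarrow> real set \<Rightarrow> bool" where
  "bandwidths n H \<longleftrightarrow>
     finite H \<and> 1 \<le> card H \<and> card H \<le> n \<and> H \<subseteq> {0..1} \<and> (\<forall>h\<in>H. 1 / real n < h)"

definition c_KY :: "'a measure \<Rightarrow> (real \<Rightarrow> real) \<Rightarrow> (nat \<Rightarrow> 'a \<Rightarrow> real) \<Rightarrow> real" where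
  "c_KY M K Y = (Lp_norm 2 K)\<^sup>2 * (\<integral>\<omega>. (Y 1 \<omega>)\<^sup>2 \<partial>M)"

definition GL_V :: "'a measure \<Rightarrow> (real \<Rightarrow> real) \<Rightarrow> (nat \<Rightarrow> 'a \<Rightarrow> real) \<Rightarrow> real
    \<Rightarrow> nat \<Rightarrow> real \<Rightarrow> real" where
  "GL_V M K Y \<upsilon> n h = \<upsilon> * (c_KY M K Y / (real n * h)) * (Lp_norm 1 K)\<^sup>2"

definition GL_A :: "'a measure \<Rightarrow> (real \<Rightarrow> real) \<Rightarrow> (nat \<Rightarrow> 'a \<Rightarrow> real) \<Rightarrow> (nat \<Rightarrow> 'a \<Rightarrow> real)
    \<Rightarrow> real \<Rightarrow> nat \<Rightarrow> real set \<Rightarrow> 'a \<Rightarrow> real \<Rightarrow> real" where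
  "GL_A M K X Y \<upsilon> n H \<omega> h =
     (SUP \<eta>\<in>H. max 0
        ((Lp_norm 2 (\<lambda>x. bf_hat2 K X Y n h \<eta> \<omega> x - bf_hat K X Y n \<eta> \<omega> x))\<^sup>2
          - GL_V M K Y \<upsilon> n \<eta>))"

text \<open>Ties between minimizers may be broken in any way, even non-measurably in \<open>\<omega>\<close>.\<close>

definition GL_selection :: "'a measure \<Rightarrow> (real \<Rightarrow> real) \<Rightarrow> (nat \<Rightarrow> 'a \<Rightarrow> real)
    \<Rightarrow> (nat \<Rightarrow> 'a \<Rightarrow> real) \<Rightarrow> real \<Rightarrow> nat \<Rightarrow> real set \<Rightarrow> ('a \<Rightarrow> real) \<Rightarrow> bool" where
  "GL_selection M K X Y \<upsilon> n H hhat \<longleftrightarrow>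
     (\<forall>\<omega>\<in>space M. is_arg_min (\<lambda>h. GL_A M K X Y \<upsilon> n H \<omega> h + GL_V M K Y \<upsilon> n h)
        (\<lambda>h. h \<in> H) (hhat \<omega>))"

end

theory Submission
  imports Defs
begin

text \<open>For a fixed sample, the Goldenshluger-Lepski comparison bounds the loss of the selected
  estimator by bias plus variance at any bandwidth, up to the sum over the bandwidths of the excess
  of the squared deviation \<open>\<parallel>F\<^sub>h - E F\<^sub>h\<parallel>\<^sup>2\<close> over a fraction of the penalty. It remains to show that
  this excess is small in expectation. Instead of Talagrand's inequality for empirical processes, a
  direct argument for sums \<open>S\<close> of independent centered \<open>L\<^sup>2\<close>-valued variables is used: the potential
  \<open>\<surd>(R\<^sup>2 + \<parallel>S\<parallel>\<^sup>2)\<close> has an exponential moment that only involves the mean square norm \<open>d\<close>, the weak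
  variance \<open>v\<close> and a bound \<open>B\<close> on the norm of the summands. The weak variance of a kernel summand is
  of order \<open>1 / \<surd>h\<close> while \<open>d\<close> is of order \<open>1 / h\<close>, which yields the factors \<open>exp (- c / \<surd>h)\<close>. The
  responses are truncated at a level of order \<open>\<surd>n / ln n\<close> to have bounded summands.\<close>

section \<open>Square integrable functions\<close>

text \<open>The selected bandwidth depends on the sample, so nothing is estimated at it directly.
  What makes the comparison work is that smoothing commutes,
  \<open>K_\<eta> * F_h = K_h * F_\<eta>\<close>, thanks to the evenness of \<open>K\<close>:
  comparing \<open>h\<close> with \<open>\<eta>\<close> then involves the bias only at
  \<open>h\<close> and the deviation only at \<open>\<eta>\<close>, where the penalty
  \<open>V \<eta>\<close> absorbs it. The mean of the squared deviation already has the order of the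
  penalty, so concentration needs room above it. With \<open>R^2\<close> the bound on the mean of
  \<open>\<parallel>S\<parallel>^2\<close>, the exponential moment costs about
  \<open>exp (7/4 * l * R)\<close>, while a norm beyond \<open>3 * R\<close> leaves a gain of
  \<open>exp (2 * l * R)\<close>. The threshold 144 for the penalty constant is
  \<open>8 * 2 * 9\<close>: 8 from the comparison, 2 from splitting off the large responses, 9 from
  the level \<open>3 * R\<close>. The factor \<open>k1^2\<close> of the comparison is part of
  \<open>V\<close>, so 144 fits all models and kernels. Uniformity in \<open>n\<close> is the other
  obstacle. The truncation level grows with \<open>n\<close>, but the weak variance is bounded using
  only \<open>\<bar>\<tau> y\<bar> \<le> \<bar>y\<bar>\<close> and moments of the response, hence by
  \<open>v0 / sqrt h\<close> with \<open>v0\<close> free of the level.\<close>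

definition L2 :: "'a measure \<Rightarrow> ('a \<Rightarrow> real) set" where
  "L2 N = {g \<in> borel_measurable N. integrable N (\<lambda>x. (g x)\<^sup>2)}"

lemma L2_I: "g \<in> borel_measurable N \<Longrightarrow> integrable N (\<lambda>x. (g x)\<^sup>2) \<Longrightarrow> g \<in> L2 N"
  by (simp add: L2_def)

lemma L2_measurable [measurable_dest]: "g \<in> L2 N \<Longrightarrow> g \<in> borel_measurable N"
  by (simp add: L2_def)

lemma L2_square_integrable: "g \<in> L2 N \<Longrightarrow> integrable N (\<lambda>x. (g x)\<^sup>2)"
  by (simp add: L2_def)

lemma L2_mult_integrable:
  assumes "g \<in> L2 N" "h \<in> L2 N"
  shows "integrable N (\<lambda>x. g x * h x)"
proof (rule Bochner_Integration.integrable_bound)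
  show "integrable N (\<lambda>x. (g x)\<^sup>2 + (h x)\<^sup>2)"
    using assms by (intro Bochner_Integration.integrable_add L2_square_integrable)
  show "(\<lambda>x. g x * h x) \<in> borel_measurable N"
    using L2_measurable[OF assms(1)] L2_measurable[OF assms(2)] by simp
  have "\<bar>a * c\<bar> \<le> a\<^sup>2 + c\<^sup>2" for a c :: real
    using sum_squares_bound[of "\<bar>a\<bar>" "\<bar>c\<bar>"] abs_ge_zero[of "a * c"]
    unfolding abs_mult power2_abs mult.assoc by linarith
  then show "AE x in N. norm (g x * h x) \<le> norm ((g x)\<^sup>2 + (h x)\<^sup>2)" by simp
qed

lemma L2_cmult: "g \<in> L2 N \<Longrightarrow> (\<lambda>x. c * g x) \<in> L2 N"
  by (auto simp: L2_def power_mult_distrib)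

lemma L2_mult_const: "g \<in> L2 N \<Longrightarrow> (\<lambda>x. g x * c) \<in> L2 N"
  by (auto simp: L2_def power_mult_distrib)

lemma L2_add:
  assumes "g \<in> L2 N" "h \<in> L2 N"
  shows "(\<lambda>x. g x + h x) \<in> L2 N"
proof (rule L2_I)
  show "(\<lambda>x. g x + h x) \<in> borel_measurable N"
    using L2_measurable[OF assms(1)] L2_measurable[OF assms(2)] by simp
  have "integrable N (\<lambda>x. (g x)\<^sup>2 + (h x)\<^sup>2 + 2 * (g x * h x))"
    using assms by (intro Bochner_Integration.integrable_add integrable_mult_right
        L2_square_integrable L2_mult_integrable)
  then show "integrable N (\<lambda>x. (g x + h x)\<^sup>2)"
    by (simp add: power2_sum algebra_simps)
qed

lemma L2_diff:
  assumes "g \<in> L2 N" "h \<in> L2 N"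
  shows "(\<lambda>x. g x - h x) \<in> L2 N"
  using L2_add[OF assms(1) L2_cmult[OF assms(2), of "-1"]] by simp

lemma L2_zero: "(\<lambda>x. 0) \<in> L2 N"
  by (simp add: L2_def)

lemma L2_sum: "(\<And>i. i \<in> I \<Longrightarrow> g i \<in> L2 N) \<Longrightarrow> (\<lambda>x. \<Sum>i\<in>I. g i x) \<in> L2 N"
  by (induction I rule: infinite_finite_induct) (auto intro: L2_zero L2_add)

definition nsq :: "'a measure \<Rightarrow> ('a \<Rightarrow> real) \<Rightarrow> real" where
  "nsq N g = (\<integral>x. (g x)\<^sup>2 \<partial>N)"

lemma nsq_nonneg: "0 \<le> nsq N g"
  by (simp add: nsq_def)

lemma nsq_cmult: "nsq N (\<lambda>x. c * g x) = c\<^sup>2 * nsq N g"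
  by (simp add: nsq_def power_mult_distrib)

lemma nsq_add:
  assumes "g \<in> L2 N" "h \<in> L2 N"
  shows "nsq N (\<lambda>x. g x + h x) = nsq N g + 2 * (\<integral>x. g x * h x \<partial>N) + nsq N h"
proof -
  have "nsq N (\<lambda>x. g x + h x) = (\<integral>x. (g x)\<^sup>2 + 2 * (g x * h x) + (h x)\<^sup>2 \<partial>N)"
    unfolding nsq_def by (rule Bochner_Integration.integral_cong) (auto simp: power2_sum)
  also have "\<dots> = nsq N g + 2 * (\<integral>x. g x * h x \<partial>N) + nsq N h"
    using assms unfolding nsq_def
    by (subst Bochner_Integration.integral_add, simp_all add: L2_square_integrable L2_mult_integrable)+
  finally show ?thesis .
qed

lemma nsq_add_le:
  assumes "g \<in> L2 N" "h \<in> L2 N"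
  shows "nsq N (\<lambda>x. g x + h x) \<le> 2 * nsq N g + 2 * nsq N h"
proof -
  have "nsq N (\<lambda>x. g x + h x) \<le> (\<integral>x. 2 * (g x)\<^sup>2 + 2 * (h x)\<^sup>2 \<partial>N)"
    unfolding nsq_def
  proof (rule integral_mono)
    show "integrable N (\<lambda>x. (g x + h x)\<^sup>2)"
      by (rule L2_square_integrable[OF L2_add[OF assms]])
    show "(g x + h x)\<^sup>2 \<le> 2 * (g x)\<^sup>2 + 2 * (h x)\<^sup>2" for x
      using sum_squares_bound[of "g x" "h x"] by (simp add: power2_sum)
  qed (use assms in \<open>simp add: L2_square_integrable\<close>)
  also have "\<dots> = 2 * nsq N g + 2 * nsq N h"
    using assms by (simp add: nsq_def L2_square_integrable)
  finally show ?thesis .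
qed

text \<open>The quadratic polynomial \<open>t \<mapsto> nsq N (g + t * h)\<close> is nonnegative;
  evaluating it at its minimizer \<open>- q / nsq N h\<close> gives the bound. If
  \<open>nsq N h = 0\<close> it is affine in \<open>t\<close>, which forces
  \<open>q = 0\<close>.\<close>

lemma L2_Cauchy_Schwarz:
  assumes "g \<in> L2 N" "h \<in> L2 N"
  shows "(\<integral>x. g x * h x \<partial>N)\<^sup>2 \<le> nsq N g * nsq N h"
proof -
  define q where "q = (\<integral>x. g x * h x \<partial>N)"
  have *: "0 \<le> nsq N g + 2 * t * q + t\<^sup>2 * nsq N h" for t
    using nsq_nonneg[of N "\<lambda>x. g x + t * h x"] nsq_add[OF assms(1) L2_cmult[OF assms(2), of t]]
    by (simp add: nsq_cmult q_def mult.left_commute[of _ t] mult.assoc)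
  show ?thesis
  proof (cases "nsq N h = 0")
    case True
    have "q = 0"
    proof (rule ccontr)
      assume "q \<noteq> 0"
      \<comment> \<open>At this \<open>t\<close> the affine function takes the value -1.\<close>
      then show False using *[of "- (nsq N g + 1) / (2 * q)"] True
        by (simp add: field_simps)
    qed
    then show ?thesis using True by (simp add: q_def)
  next
    case False
    then have pos: "nsq N h > 0" using nsq_nonneg[of N h] by simp
    have "0 \<le> nsq N g - q\<^sup>2 / nsq N h"
      using *[of "- q / nsq N h"] pos by (simp add: power2_eq_square field_simps)
    then show ?thesis using pos by (simp add: q_def field_simps)
  qed
qed

lemma Lp_norm_2_power2: "(Lp_norm 2 g)\<^sup>2 = nsq lborel g"
proof -
  have "\<bar>y\<bar> powr 2 = y\<^sup>2" for y :: real
    by (cases "y = 0") (simp_all add: powr_numeral)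
  moreover have "(nsq lborel g powr (1 / 2))\<^sup>2 = nsq lborel g"
    using nsq_nonneg[of lborel g] by (simp add: powr_half_sqrt)
  ultimately show ?thesis by (simp add: Lp_norm_def nsq_def)
qed

section \<open>Concentration of sums of independent square integrable random functions\<close>

lemma (in finite_measure) L2_integrable: "g \<in> L2 M \<Longrightarrow> integrable M g"
  by (rule square_integrable_imp_integrable) (simp_all add: L2_def)

text \<open>Centering is stated weakly, as vanishing mean of the inner product with every fixed
  \<open>u\<close>, which avoids integrals with values in a function space. Inductions over the
  sample need exactly this, with \<open>u\<close> the sum of the earlier summands.\<close>

locale L2_variable = prob_space P + N: sigma_finite_measure N
  for P :: "'z measure" and N :: "'x measure" +
  fixes \<xi> :: "'z \<Rightarrow> 'x \<Rightarrow> real" and d :: real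
  assumes \<xi>_measurable [measurable]: "case_prod \<xi> \<in> borel_measurable (P \<Otimes>\<^sub>M N)"
    and \<xi>_L2: "\<And>w. w \<in> space P \<Longrightarrow> \<xi> w \<in> L2 N"
    and \<xi>_centered: "\<And>u. u \<in> L2 N \<Longrightarrow> (\<integral>w. (\<integral>x. u x * \<xi> w x \<partial>N) \<partial>P) = 0"
    and nsq_\<xi>_le: "(\<integral>\<^sup>+w. ennreal (nsq N (\<xi> w)) \<partial>P) \<le> ennreal d"
    and d_nonneg: "0 \<le> d"
begin

sublocale product_sigma_finite "\<lambda>i. P"
  by unfold_locales

definition S :: "nat set \<Rightarrow> (nat \<Rightarrow> 'z) \<Rightarrow> 'x \<Rightarrow> real" where
  "S I z x = (\<Sum>i\<in>I. \<xi> (z i) x)"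

lemma S_insert: "finite I \<Longrightarrow> k \<notin> I \<Longrightarrow> S (insert k I) (z(k := w)) = (\<lambda>x. S I z x + \<xi> w x)"
  by (auto simp: S_def fun_eq_iff add.commute intro!: sum.cong)

lemma S_L2: "z \<in> space (PiM I (\<lambda>_. P)) \<Longrightarrow> S I z \<in> L2 N"
  unfolding S_def by (intro L2_sum \<xi>_L2) (auto simp: space_PiM)

lemma measurable_S [measurable]:
  "case_prod (S I) \<in> borel_measurable (PiM I (\<lambda>_. P) \<Otimes>\<^sub>M N)"
  unfolding S_def split_beta' by measurable

lemma measurable_nsq_S [measurable]:
  "(\<lambda>z. nsq N (S I z)) \<in> borel_measurable (PiM I (\<lambda>_. P))"
  unfolding nsq_def
  by (rule N.borel_measurable_lebesgue_integral) (use measurable_S in measurable)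

lemma measurable_nsq_\<xi> [measurable]: "(\<lambda>w. nsq N (\<xi> w)) \<in> borel_measurable P"
  unfolding nsq_def by measurable

lemma measurable_inner_\<xi>:
  assumes "u \<in> L2 N"
  shows "(\<lambda>w. \<integral>x. u x * \<xi> w x \<partial>N) \<in> borel_measurable P"
proof -
  note [measurable] = L2_measurable[OF assms]
  show ?thesis by measurable
qed

lemma integrable_nsq_\<xi>: "integrable P (\<lambda>w. nsq N (\<xi> w))"
proof (rule integrableI_nonneg)
  show "(\<integral>\<^sup>+w. ennreal (nsq N (\<xi> w)) \<partial>P) < \<infinity>"
    using nsq_\<xi>_le by (rule order_le_less_trans) simp
qed (auto simp: nsq_nonneg)

lemma integral_nsq_\<xi>_le: "(\<integral>w. nsq N (\<xi> w) \<partial>P) \<le> d"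
  using nsq_\<xi>_le d_nonneg
  by (simp add: nn_integral_eq_integral[OF integrable_nsq_\<xi>] nsq_nonneg)

lemma inner_\<xi>_L2:
  assumes u: "u \<in> L2 N"
  shows "(\<lambda>w. \<integral>x. u x * \<xi> w x \<partial>N) \<in> L2 P"
proof (rule L2_I)
  note [measurable] = measurable_inner_\<xi>[OF u]
  show "(\<lambda>w. \<integral>x. u x * \<xi> w x \<partial>N) \<in> borel_measurable P" by measurable
  show "integrable P (\<lambda>w. (\<integral>x. u x * \<xi> w x \<partial>N)\<^sup>2)"
  proof (rule Bochner_Integration.integrable_bound)
    show "integrable P (\<lambda>w. nsq N u * nsq N (\<xi> w))"
      by (intro integrable_mult_right integrable_nsq_\<xi>)
    show "AE w in P. norm ((\<integral>x. u x * \<xi> w x \<partial>N)\<^sup>2) \<le> norm (nsq N u * nsq N (\<xi> w))"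
      using L2_Cauchy_Schwarz[OF u \<xi>_L2] by (intro AE_I2) (simp add: nsq_nonneg)
  qed measurable
qed

lemma integrable_inner_\<xi>: "u \<in> L2 N \<Longrightarrow> integrable P (\<lambda>w. \<integral>x. u x * \<xi> w x \<partial>N)"
  by (rule L2_integrable[OF inner_\<xi>_L2])

text \<open>Orthogonality of independent centered summands: given the earlier coordinates, the cross
  term has mean zero, so mean square norms add up. This controls the part of the sum that comes from
  large responses.\<close>

lemma nn_integral_nsq_S_le:
  "finite I \<Longrightarrow> (\<integral>\<^sup>+z. ennreal (nsq N (S I z)) \<partial>PiM I (\<lambda>_. P)) \<le> ennreal (real (card I) * d)"
proof (induction I rule: finite_induct)
  case empty
  then show ?case by (simp add: S_def nsq_def)
next
  case (insert k I)
  have step: "(\<integral>\<^sup>+w. ennreal (nsq N (S (insert k I) (z(k := w)))) \<partial>P)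
      \<le> ennreal (nsq N (S I z)) + ennreal d" if z: "z \<in> space (PiM I (\<lambda>_. P))" for z
  proof -
    note u = S_L2[OF z]
    let ?g = "\<lambda>w. nsq N (S I z) + 2 * (\<integral>x. S I z x * \<xi> w x \<partial>N) + nsq N (\<xi> w)"
    have "(\<integral>\<^sup>+w. ennreal (nsq N (S (insert k I) (z(k := w)))) \<partial>P) = (\<integral>\<^sup>+w. ennreal (?g w) \<partial>P)"
      using insert.hyps by (intro nn_integral_cong) (simp add: S_insert nsq_add[OF u \<xi>_L2])
    also have "\<dots> = ennreal (\<integral>w. ?g w \<partial>P)"
    proof (rule nn_integral_eq_integral)
      show "integrable P ?g" using integrable_inner_\<xi>[OF u] integrable_nsq_\<xi> by simp
      show "AE w in P. 0 \<le> ?g w"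
        using nsq_add[OF u \<xi>_L2] nsq_nonneg[of N] by (intro AE_I2) (metis (no_types, lifting))
    qed
    also have "(\<integral>w. ?g w \<partial>P) = nsq N (S I z) + (\<integral>w. nsq N (\<xi> w) \<partial>P)"
      using integrable_inner_\<xi>[OF u] integrable_nsq_\<xi> \<xi>_centered[OF u] by (simp add: prob_space)
    also have "ennreal \<dots> \<le> ennreal (nsq N (S I z)) + ennreal d"
      using integral_nsq_\<xi>_le d_nonneg by (simp add: nsq_nonneg flip: ennreal_plus)
    finally show ?thesis .
  qed
  have "(\<integral>\<^sup>+z. ennreal (nsq N (S (insert k I) z)) \<partial>PiM (insert k I) (\<lambda>_. P))
      = (\<integral>\<^sup>+z. \<integral>\<^sup>+w. ennreal (nsq N (S (insert k I) (z(k := w)))) \<partial>P \<partial>PiM I (\<lambda>_. P))"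
    using insert.hyps by (intro product_nn_integral_insert) auto
  also have "\<dots> \<le> (\<integral>\<^sup>+z. ennreal (nsq N (S I z)) + ennreal d \<partial>PiM I (\<lambda>_. P))"
    by (intro nn_integral_mono step)
  also have "\<dots> = (\<integral>\<^sup>+z. ennreal (nsq N (S I z)) \<partial>PiM I (\<lambda>_. P)) + ennreal d"
  proof -
    interpret I: prob_space "PiM I (\<lambda>_. P)" by (rule prob_space_PiM) (rule prob_space_axioms)
    show ?thesis by (subst nn_integral_add) (auto simp: I.emeasure_space_1)
  qed
  also have "\<dots> \<le> ennreal (real (card I) * d) + ennreal d"
    by (intro add_mono insert.IH order_refl)
  also have "\<dots> = ennreal (real (card (insert k I)) * d)"
    using insert.hyps d_nonneg by (simp add: algebra_simps flip: ennreal_plus)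
  finally show ?case .
qed

end

section \<open>Exponential moments and integrated large deviations of the sum\<close>

lemma exp_le_quadratic:
  fixes x :: real
  assumes "\<bar>x\<bar> \<le> 1"
  shows "exp x \<le> 1 + x + x\<^sup>2"
proof (cases "0 \<le> x")
  case True
  then show ?thesis using assms by (intro exp_bound) auto
next
  case False
  define y where "y = - x"
  have y: "0 \<le> y" "y \<le> 1" using False assms by (auto simp: y_def)
  \<comment> \<open>The second factor is the Taylor lower bound of \<open>exp y\<close>; a product
    of at least 1 therefore makes the first factor at least \<open>exp (- y)\<close>.\<close>
  have "(1 - y + y\<^sup>2) * (1 + y + y\<^sup>2 / 2) = 1 + (y\<^sup>2 + y ^ 3 + y ^ 4) / 2"
    by (simp add: field_simps power2_eq_square power3_eq_cube power4_eq_xxxx)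
  then have "1 \<le> (1 - y + y\<^sup>2) * (1 + y + y\<^sup>2 / 2)"
    using y by simp
  also have "\<dots> \<le> (1 - y + y\<^sup>2) * exp y"
    using y exp_lower_Taylor_quadratic[OF y(1)] by (intro mult_left_mono) auto
  finally have "exp (- y) \<le> 1 - y + y\<^sup>2"
    by (simp add: exp_minus divide_simps)
  then show ?thesis by (simp add: y_def)
qed

text \<open>The potential \<open>\<surd>(R\<^sup>2 + \<parallel>S\<parallel>\<^sup>2)\<close> replaces the norm, which is not smooth at 0:
  adding one summand \<open>\<xi>\<close> changes it by at most \<open>\<langle>S, \<xi>\<rangle> / \<surd>(R\<^sup>2 + \<parallel>S\<parallel>\<^sup>2) + \<parallel>\<xi>\<parallel>\<^sup>2 / (2 R)\<close>.\<close>

lemma sqrt_increment_le: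
  fixes Q D l R :: real
  assumes "0 < R" "0 \<le> Q" "0 \<le> Q + 2 * l + D" "0 \<le> D"
  shows "sqrt (R\<^sup>2 + (Q + 2 * l + D)) \<le> sqrt (R\<^sup>2 + Q) + (l / sqrt (R\<^sup>2 + Q) + D / (2 * R))"
proof -
  define a where "a = sqrt (R\<^sup>2 + Q)"
  have aR: "R \<le> a" unfolding a_def using assms by (intro real_le_rsqrt) auto
  have a2: "a\<^sup>2 = R\<^sup>2 + Q" using assms by (simp add: a_def)
  have pos: "0 < a" using aR assms by simp
  \<comment> \<open>Tangent line of the concave square root at \<open>a^2\<close>. Afterwards
    \<open>D / (2 * a)\<close> is enlarged to \<open>D / (2 * R)\<close>, which no longer depends on
    the earlier summands.\<close>
  have "sqrt (a\<^sup>2 + (2 * l + D)) \<le> a + (2 * l + D) / (2 * a)"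
  proof (rule real_le_lsqrt)
    have "0 \<le> a\<^sup>2 + (a\<^sup>2 + (2 * l + D))" using a2 assms by simp
    then show "0 \<le> a + (2 * l + D) / (2 * a)" using pos
      by (simp add: field_simps power2_eq_square)
    have "(a + (2 * l + D) / (2 * a))\<^sup>2 = a\<^sup>2 + (2 * l + D) + ((2 * l + D) / (2 * a))\<^sup>2"
      using pos by (simp add: power2_sum)
    then show "a\<^sup>2 + (2 * l + D) \<le> (a + (2 * l + D) / (2 * a))\<^sup>2" by simp
  qed
  also have "\<dots> \<le> a + (l / a + D / (2 * R))"
    using aR pos assms by (simp add: add_divide_distrib frac_le)
  finally show ?thesis by (simp add: a2 add.assoc flip: a_def)
qed

context L2_variable
begin

text \<open>Induction over the sample: given the earlier summands, one more multiplies the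
  exponential moment by at most \<open>exp c\<close>. The condition on \<open>l\<close> keeps the
  increment \<open>x\<close> of the exponent in \<open>[-1, 1]\<close>, where
  \<open>exp x \<le> 1 + x + x^2\<close>. The inner product in \<open>x\<close> has mean zero, and
  its square has mean at most \<open>v * nsq N u \<le> v * a^2\<close>, so that the division by
  \<open>a\<close> cancels the size of the earlier sum.\<close>

lemma nn_integral_exp_le:
  assumes bound: "\<And>w. w \<in> space P \<Longrightarrow> nsq N (\<xi> w) \<le> B\<^sup>2"
    and weak: "\<And>u. u \<in> L2 N \<Longrightarrow> (\<integral>w. (\<integral>x. u x * \<xi> w x \<partial>N)\<^sup>2 \<partial>P) \<le> v * nsq N u"
    and B: "0 \<le> B" and v: "0 \<le> v" and R: "0 < R" and l: "0 \<le> l" "l * (B + B\<^sup>2 / (2 * R)) \<le> 1"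
    and I: "finite I"
  shows "(\<integral>\<^sup>+z. ennreal (exp (l * sqrt (R\<^sup>2 + nsq N (S I z)))) \<partial>PiM I (\<lambda>_. P))
    \<le> ennreal (exp (l * R + real (card I) * (l * d / (2 * R) + 2 * l\<^sup>2 * v + l\<^sup>2 * B\<^sup>2 * d / (2 * R\<^sup>2))))"
  using I
proof (induction I rule: finite_induct)
  case empty
  interpret E: prob_space "PiM {} (\<lambda>_::nat. P)" by (rule prob_space_PiM) (rule prob_space_axioms)
  show ?case using R by (simp add: S_def nsq_def E.emeasure_space_1)
next
  case (insert k I)
  define c where "c = l * d / (2 * R) + 2 * l\<^sup>2 * v + l\<^sup>2 * B\<^sup>2 * d / (2 * R\<^sup>2)"
  have step: "(\<integral>\<^sup>+w. ennreal (exp (l * sqrt (R\<^sup>2 + nsq N (S (insert k I) (z(k := w)))))) \<partial>P)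
      \<le> ennreal (exp (l * sqrt (R\<^sup>2 + nsq N (S I z)))) * ennreal (exp c)"
    if z: "z \<in> space (PiM I (\<lambda>_. P))" for z
  proof -
    define u where "u = S I z"
    have u: "u \<in> L2 N" using S_L2[OF z] by (simp add: u_def)
    define a where "a = sqrt (R\<^sup>2 + nsq N u)"
    have aR: "R \<le> a" unfolding a_def using R by (intro real_le_rsqrt) (auto simp: nsq_nonneg)
    have a2: "a\<^sup>2 = R\<^sup>2 + nsq N u" using nsq_nonneg[of N u] by (simp add: a_def)
    have a: "0 < a" using aR R by simp
    define L where "L = (\<lambda>w. \<integral>x. u x * \<xi> w x \<partial>N)"
    define D where "D = (\<lambda>w. nsq N (\<xi> w))"
    have D: "0 \<le> D w" for w by (simp add: D_def nsq_nonneg)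
    \<comment> \<open>Majorant of \<open>exp x\<close> by terms with known integrals:
      \<open>1 + x + x^2\<close>, where \<open>(s + t)^2 \<le> 2 * s^2 + 2 * t^2\<close> separates
      the two parts of \<open>x\<close> and one factor of \<open>D^2\<close> is replaced by
      \<open>B^2\<close>.\<close>
    define g where "g = (\<lambda>w. 1 + l / a * L w + l / (2 * R) * D w + 2 * l\<^sup>2 / a\<^sup>2 * (L w)\<^sup>2
      + l\<^sup>2 * B\<^sup>2 / (2 * R\<^sup>2) * D w)"
    have exp_le: "exp (l * sqrt (R\<^sup>2 + nsq N (S (insert k I) (z(k := w))))) \<le> exp (l * a) * g w"
      and g_nonneg: "0 \<le> g w"
      if w: "w \<in> space P" for w
    proof -
      have DB: "D w \<le> B\<^sup>2" using bound[OF w] by (simp add: D_def)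
      have nsq_eq: "nsq N (S (insert k I) (z(k := w))) = nsq N u + 2 * L w + D w"
        using insert.hyps nsq_add[OF u \<xi>_L2[OF w]] by (simp add: S_insert L_def D_def flip: u_def)
      define x where "x = l * (L w / a + D w / (2 * R))"
      have "(L w)\<^sup>2 \<le> nsq N u * D w"
        using L2_Cauchy_Schwarz[OF u \<xi>_L2[OF w]] by (simp add: L_def D_def)
      also have "\<dots> \<le> a\<^sup>2 * B\<^sup>2"
        using DB by (intro mult_mono) (simp_all add: a2 nsq_nonneg D)
      finally have "\<bar>L w\<bar> \<le> a * B"
        using a B by (simp add: abs_le_square_iff[symmetric] flip: power_mult_distrib)
      then have La: "\<bar>L w / a\<bar> \<le> B" using a by (simp add: field_simps)
      have DR: "D w / (2 * R) \<le> B\<^sup>2 / (2 * R)" "0 \<le> D w / (2 * R)"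
        using DB R D by (auto intro!: divide_right_mono)
      have "\<bar>L w / a + D w / (2 * R)\<bar> \<le> B + B\<^sup>2 / (2 * R)"
        using La DR by linarith
      then have "\<bar>x\<bar> \<le> l * (B + B\<^sup>2 / (2 * R))"
        unfolding x_def abs_mult using l(1) by (simp add: mult_left_mono)
      then have x1: "\<bar>x\<bar> \<le> 1" using l(2) by simp
      have "x\<^sup>2 \<le> 2 * (l\<^sup>2 * (L w / a)\<^sup>2) + 2 * (l\<^sup>2 * (D w / (2 * R))\<^sup>2)"
      proof -
        have "(L w / a + D w / (2 * R))\<^sup>2 \<le> 2 * (L w / a)\<^sup>2 + 2 * (D w / (2 * R))\<^sup>2"
          using sum_squares_bound[of "L w / a" "D w / (2 * R)"] unfolding power2_sum by linarith
        then have "l\<^sup>2 * (L w / a + D w / (2 * R))\<^sup>2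
            \<le> l\<^sup>2 * (2 * (L w / a)\<^sup>2 + 2 * (D w / (2 * R))\<^sup>2)"
          by (rule mult_left_mono) simp
        moreover have "x\<^sup>2 = l\<^sup>2 * (L w / a + D w / (2 * R))\<^sup>2"
          by (simp only: x_def power_mult_distrib)
        ultimately show ?thesis unfolding distrib_left by linarith
      qed
      also have "l\<^sup>2 * (D w / (2 * R))\<^sup>2 \<le> l\<^sup>2 * (B\<^sup>2 * D w / (4 * R\<^sup>2))"
      proof (rule mult_left_mono)
        have "D w * D w \<le> B\<^sup>2 * D w" using DB D by (intro mult_right_mono)
        then show "(D w / (2 * R))\<^sup>2 \<le> B\<^sup>2 * D w / (4 * R\<^sup>2)"
          using R by (simp add: power_divide power_mult_distrib divide_right_mono power2_eq_square)
      qed simp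
      finally have x2: "x\<^sup>2 \<le> 2 * l\<^sup>2 / a\<^sup>2 * (L w)\<^sup>2 + l\<^sup>2 * B\<^sup>2 / (2 * R\<^sup>2) * D w"
        by (simp add: power_divide field_simps)
      have gx: "g w = 1 + x + (2 * l\<^sup>2 / a\<^sup>2 * (L w)\<^sup>2 + l\<^sup>2 * B\<^sup>2 / (2 * R\<^sup>2) * D w)"
        by (simp add: g_def x_def algebra_simps)
      have ex: "exp x \<le> g w"
        using exp_le_quadratic[OF x1] x2 unfolding gx by linarith
      then show "0 \<le> g w" using exp_ge_zero[of x] by linarith
      have "sqrt (R\<^sup>2 + (nsq N u + 2 * L w + D w)) \<le> a + (L w / a + D w / (2 * R))"
        unfolding a_def
        by (rule sqrt_increment_le) (use R D nsq_nonneg[of N "S (insert k I) (z(k := w))"] in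
          \<open>simp_all add: nsq_nonneg nsq_eq\<close>)
      then have "l * sqrt (R\<^sup>2 + nsq N (S (insert k I) (z(k := w)))) \<le> l * (a + (L w / a + D w / (2 * R)))"
        unfolding nsq_eq using l(1) by (rule mult_left_mono)
      also have "\<dots> = l * a + x" by (simp add: x_def algebra_simps)
      finally have "exp (l * sqrt (R\<^sup>2 + nsq N (S (insert k I) (z(k := w))))) \<le> exp (l * a) * exp x"
        by (simp add: exp_add[symmetric])
      also have "\<dots> \<le> exp (l * a) * g w" using ex by simp
      finally show "exp (l * sqrt (R\<^sup>2 + nsq N (S (insert k I) (z(k := w))))) \<le> exp (l * a) * g w" .
    qed
    have int: "integrable P L" "integrable P D" "integrable P (\<lambda>w. (L w)\<^sup>2)"
      using integrable_inner_\<xi>[OF u] integrable_nsq_\<xi> L2_square_integrable[OF inner_\<xi>_L2[OF u]]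
      by (simp_all add: L_def D_def)
    then have int_g: "integrable P g" unfolding g_def by simp
    have "(\<integral>\<^sup>+w. ennreal (exp (l * sqrt (R\<^sup>2 + nsq N (S (insert k I) (z(k := w)))))) \<partial>P)
        \<le> (\<integral>\<^sup>+w. ennreal (exp (l * a)) * ennreal (g w) \<partial>P)"
      using exp_le g_nonneg by (intro nn_integral_mono) (simp add: ennreal_leI flip: ennreal_mult)
    also have "\<dots> = ennreal (exp (l * a)) * ennreal (\<integral>w. g w \<partial>P)"
      using int_g g_nonneg
      by (subst nn_integral_cmult) (auto intro!: AE_I2 simp: nn_integral_eq_integral)
    also have "(\<integral>w. g w \<partial>P) \<le> exp c"
    proof -
      have L0: "(\<integral>w. L w \<partial>P) = 0" using \<xi>_centered[OF u] by (simp add: L_def)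
      have L2: "(\<integral>w. (L w)\<^sup>2 \<partial>P) \<le> v * a\<^sup>2"
      proof -
        have "v * nsq N u \<le> v * a\<^sup>2" using v by (intro mult_left_mono) (simp_all add: a2)
        then show ?thesis using weak[OF u] by (simp add: L_def)
      qed
      have D1: "(\<integral>w. D w \<partial>P) \<le> d" using integral_nsq_\<xi>_le by (simp add: D_def)
      have "(\<integral>w. g w \<partial>P) = 1 + l / (2 * R) * (\<integral>w. D w \<partial>P) + 2 * l\<^sup>2 / a\<^sup>2 * (\<integral>w. (L w)\<^sup>2 \<partial>P)
          + l\<^sup>2 * B\<^sup>2 / (2 * R\<^sup>2) * (\<integral>w. D w \<partial>P)"
        unfolding g_def using int by (simp add: L0 prob_space)
      also have "\<dots> \<le> 1 + l / (2 * R) * d + 2 * l\<^sup>2 / a\<^sup>2 * (v * a\<^sup>2) + l\<^sup>2 * B\<^sup>2 / (2 * R\<^sup>2) * d"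
        using l(1) R by (intro add_mono mult_left_mono D1 L2) auto
      also have "\<dots> = 1 + c" using a by (simp add: c_def)
      also have "\<dots> \<le> exp c" by (rule exp_ge_add_one_self)
      finally show ?thesis .
    qed
    finally show ?thesis by (simp add: a_def u_def ennreal_leI mult_left_mono)
  qed
  have "(\<integral>\<^sup>+z. ennreal (exp (l * sqrt (R\<^sup>2 + nsq N (S (insert k I) z)))) \<partial>PiM (insert k I) (\<lambda>_. P))
      = (\<integral>\<^sup>+z. \<integral>\<^sup>+w. ennreal (exp (l * sqrt (R\<^sup>2 + nsq N (S (insert k I) (z(k := w)))))) \<partial>P \<partial>PiM I (\<lambda>_. P))"
    using insert.hyps by (intro product_nn_integral_insert) auto
  also have "\<dots> \<le> (\<integral>\<^sup>+z. ennreal (exp (l * sqrt (R\<^sup>2 + nsq N (S I z)))) * ennreal (exp c) \<partial>PiM I (\<lambda>_. P))"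
    by (intro nn_integral_mono step)
  also have "\<dots> = (\<integral>\<^sup>+z. ennreal (exp (l * sqrt (R\<^sup>2 + nsq N (S I z)))) \<partial>PiM I (\<lambda>_. P)) * ennreal (exp c)"
    by (intro nn_integral_multc) auto
  also have "\<dots> \<le> ennreal (exp (l * R + real (card I) * c)) * ennreal (exp c)"
    using insert.IH unfolding c_def by (rule mult_right_mono) simp
  also have "\<dots> = ennreal (exp (l * R + real (card (insert k I)) * c))"
    using insert.hyps by (simp add: exp_add[symmetric] algebra_simps flip: ennreal_mult)
  finally show ?case by (simp add: c_def)
qed

text \<open>Chernoff bound in integrated form. Here \<open>R^2\<close> is the bound on the mean of
  \<open>\<parallel>S\<parallel>^2\<close>. The two terms are a Gaussian regime, governed by the
  weak variance, and a Bernstein regime, governed by the size of single summands; the parameter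
  \<open>l\<close> is optimal for one of them, and the sum covers both.\<close>

lemma nn_integral_excess_le:
  assumes bound: "\<And>w. w \<in> space P \<Longrightarrow> nsq N (\<xi> w) \<le> B\<^sup>2"
    and weak: "\<And>u. u \<in> L2 N \<Longrightarrow> (\<integral>w. (\<integral>x. u x * \<xi> w x \<partial>N)\<^sup>2 \<partial>P) \<le> v * nsq N u"
    and v: "0 < v" and R: "0 < R" and B: "0 < B" "B \<le> 2 * R"
    and I: "finite I" "R\<^sup>2 = real (card I) * d"
  shows "(\<integral>\<^sup>+z. ennreal (max 0 (nsq N (S I z) - 9 * R\<^sup>2)) \<partial>PiM I (\<lambda>_. P))
    \<le> ennreal (54 * ((8 * real (card I) * v / R)\<^sup>2 * exp (- (R\<^sup>2 / (32 * real (card I) * v)))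
        + (2 * B)\<^sup>2 * exp (- (R / (8 * B)))))"
proof -
  define n where "n = real (card I)"
  have n: "0 < n" using R I(2) by (cases "card I = 0") (auto simp: n_def)
  \<comment> \<open>The first cap keeps the weak variance cost \<open>2 * n * l^2 * v\<close> below
    \<open>l * R / 4\<close>; the second, with \<open>B \<le> 2 * R\<close>, keeps the exponent of a
    single step at most 1.\<close>
  define l where "l = min (R / (8 * n * v)) (1 / (2 * B))"
  have l: "0 < l" using n v R B by (simp add: l_def)
  have lB: "l * B \<le> 1 / 2"
    using B(1) mult_right_mono[of l "1 / (2 * B)" B] by (simp add: l_def)
  have lB2: "l * (B + B\<^sup>2 / (2 * R)) \<le> 1"
  proof -
    have "B * (B / (2 * R)) \<le> B * 1"
      using B R by (intro mult_left_mono) (auto simp: field_simps)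
    then have "l * (B + B\<^sup>2 / (2 * R)) \<le> l * (2 * B)"
      using l by (intro mult_left_mono) (auto simp: power2_eq_square)
    then show ?thesis using lB by simp
  qed
  have lv: "2 * n * l\<^sup>2 * v \<le> l * R / 4"
  proof -
    have "l * (8 * n * v) \<le> R / (8 * n * v) * (8 * n * v)"
      using n v by (intro mult_right_mono) (auto simp: l_def)
    then have "l * (l * (8 * n * v)) \<le> l * R"
      using l n v by (intro mult_left_mono) auto
    then show ?thesis by (simp add: power2_eq_square algebra_simps)
  qed
  \<comment> \<open>Beyond \<open>9 * R^2\<close> the norm \<open>q\<close> satisfies
    \<open>q \<le> 3 * (q - 2 * R)\<close>, and \<open>y^2 / 2 \<le> exp y\<close> for nonnegative
    \<open>y\<close> turns the square into an exponential tilted by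
    \<open>exp (- 2 * l * R)\<close>.\<close>
  have pt: "max 0 (t - 9 * R\<^sup>2) \<le> 18 / l\<^sup>2 * exp (- (2 * l * R)) * exp (l * sqrt (R\<^sup>2 + t))"
    if t: "0 \<le> t" for t
  proof (cases "t \<le> 9 * R\<^sup>2")
    case True
    then show ?thesis using l by simp
  next
    case False
    define q where "q = sqrt t"
    have qt: "t = q\<^sup>2" using t by (simp add: q_def)
    have "3 * R \<le> q" unfolding q_def using False by (intro real_le_rsqrt) (simp add: power_mult_distrib)
    then have q: "0 \<le> q - 2 * R" "q \<le> 3 * (q - 2 * R)" "0 \<le> q" using R by auto
    have "t \<le> 9 * (q - 2 * R)\<^sup>2"
      unfolding qt using power_mono[OF q(2,3), of 2] by (simp only: power_mult_distrib) simp
    also have "\<dots> = 18 / l\<^sup>2 * ((l * (q - 2 * R))\<^sup>2 / 2)"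
      using l by (simp add: power_mult_distrib)
    also have "\<dots> \<le> 18 / l\<^sup>2 * (exp (- (2 * l * R)) * exp (l * sqrt (R\<^sup>2 + t)))"
    proof (rule mult_left_mono)
      have "0 \<le> l * (q - 2 * R)" using l q by simp
      from exp_lower_Taylor_quadratic[OF this]
      have "(l * (q - 2 * R))\<^sup>2 / 2 \<le> exp (l * (q - 2 * R))" using \<open>0 \<le> l * (q - 2 * R)\<close> by linarith
      also have "\<dots> \<le> exp (- (2 * l * R)) * exp (l * sqrt (R\<^sup>2 + t))"
      proof -
        have "l * q \<le> l * sqrt (R\<^sup>2 + t)" using l by (intro mult_left_mono) (simp_all add: q_def)
        then show ?thesis by (simp add: exp_add[symmetric] algebra_simps)
      qed
      finally show "(l * (q - 2 * R))\<^sup>2 / 2 \<le> exp (- (2 * l * R)) * exp (l * sqrt (R\<^sup>2 + t))" .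
    qed simp
    finally have "t \<le> 18 / l\<^sup>2 * exp (- (2 * l * R)) * exp (l * sqrt (R\<^sup>2 + t))"
      by (simp only: mult.assoc)
    moreover have "max 0 (t - 9 * R\<^sup>2) \<le> t" using t by simp
    ultimately show ?thesis by linarith
  qed
  define C where "C = 18 / l\<^sup>2 * exp (- (2 * l * R))"
  have C: "0 \<le> C" by (simp add: C_def)
  have "(\<integral>\<^sup>+z. ennreal (max 0 (nsq N (S I z) - 9 * R\<^sup>2)) \<partial>PiM I (\<lambda>_. P))
      \<le> (\<integral>\<^sup>+z. ennreal C * ennreal (exp (l * sqrt (R\<^sup>2 + nsq N (S I z)))) \<partial>PiM I (\<lambda>_. P))"
    using C pt[folded C_def, OF nsq_nonneg]
    by (intro nn_integral_mono) (simp add: ennreal_leI flip: ennreal_mult)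
  also have "\<dots> = ennreal C * (\<integral>\<^sup>+z. ennreal (exp (l * sqrt (R\<^sup>2 + nsq N (S I z)))) \<partial>PiM I (\<lambda>_. P))"
    by (intro nn_integral_cmult) auto
  also have "\<dots> \<le> ennreal C * ennreal (exp (l * R + n * (l * d / (2 * R) + 2 * l\<^sup>2 * v
      + l\<^sup>2 * B\<^sup>2 * d / (2 * R\<^sup>2))))"
    unfolding n_def using v B(1) R l lB2 I(1)
    by (intro mult_left_mono nn_integral_exp_le bound weak) auto
  also have "\<dots> = ennreal (C * exp (l * R + n * (l * d / (2 * R) + 2 * l\<^sup>2 * v
      + l\<^sup>2 * B\<^sup>2 * d / (2 * R\<^sup>2))))"
    using C by (simp add: ennreal_mult)
  also have "\<dots> \<le> ennreal (54 / l\<^sup>2 * exp (- (l * R / 4)))"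
  proof (rule ennreal_leI)
    have "n * (l * d / (2 * R)) = l * (n * d) / (2 * R)" by simp
    also have "n * d = R\<^sup>2" using I(2) by (simp add: n_def)
    also have "l * R\<^sup>2 / (2 * R) = l * R / 2" using R by (simp add: power2_eq_square)
    finally have e1: "n * (l * d / (2 * R)) = l * R / 2" .
    have "n * (l\<^sup>2 * B\<^sup>2 * d / (2 * R\<^sup>2)) = l\<^sup>2 * B\<^sup>2 * (n * d) / (2 * R\<^sup>2)" by simp
    also have "n * d = R\<^sup>2" using I(2) by (simp add: n_def)
    also have "l\<^sup>2 * B\<^sup>2 * R\<^sup>2 / (2 * R\<^sup>2) = (l * B)\<^sup>2 / 2" using R by (simp add: power_mult_distrib)
    also have "\<dots> \<le> 1 / 2"
      using lB l B(1) power_mono[of "l * B" 1 2] by simp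
    finally have e2: "n * (l\<^sup>2 * B\<^sup>2 * d / (2 * R\<^sup>2)) \<le> 1 / 2" .
    have "l * R + n * (l * d / (2 * R) + 2 * l\<^sup>2 * v + l\<^sup>2 * B\<^sup>2 * d / (2 * R\<^sup>2))
        = l * R + n * (l * d / (2 * R)) + 2 * n * l\<^sup>2 * v + n * (l\<^sup>2 * B\<^sup>2 * d / (2 * R\<^sup>2))"
      by (simp add: algebra_simps)
    \<comment> \<open>Start value, mean square norm, weak variance and squared second-order term.
      Against the \<open>2 * l * R\<close> in \<open>C\<close> a decay of \<open>l * R / 4\<close>
      survives; \<open>exp (1 / 2) \<le> 3\<close> then turns 18 into 54.\<close>
    also have "\<dots> \<le> l * R + l * R / 2 + l * R / 4 + 1 / 2"
      using e1 e2 lv by linarith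
    finally have "C * exp (l * R + n * (l * d / (2 * R) + 2 * l\<^sup>2 * v + l\<^sup>2 * B\<^sup>2 * d / (2 * R\<^sup>2)))
        \<le> C * exp (l * R + l * R / 2 + l * R / 4 + 1 / 2)"
      using C by (intro mult_left_mono) auto
    also have "\<dots> = 18 / l\<^sup>2 * (exp (- (l * R / 4)) * exp (1 / 2))"
      unfolding C_def mult.assoc exp_add[symmetric] by (simp add: field_simps)
    also have "\<dots> \<le> 18 / l\<^sup>2 * (exp (- (l * R / 4)) * 3)"
    proof -
      have "exp (1 / 2 :: real) \<le> exp 1" by simp
      also have "\<dots> \<le> 3" by (rule exp_le)
      finally show ?thesis by (intro mult_left_mono) auto
    qed
    finally show "C * exp (l * R + n * (l * d / (2 * R) + 2 * l\<^sup>2 * v + l\<^sup>2 * B\<^sup>2 * d / (2 * R\<^sup>2)))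
        \<le> 54 / l\<^sup>2 * exp (- (l * R / 4))" by simp
  qed
  also have "\<dots> \<le> ennreal (54 * ((8 * n * v / R)\<^sup>2 * exp (- (R\<^sup>2 / (32 * n * v)))
        + (2 * B)\<^sup>2 * exp (- (R / (8 * B)))))"
  proof (rule ennreal_leI)
    have "1 / l\<^sup>2 * exp (- (l * R / 4)) \<le> (8 * n * v / R)\<^sup>2 * exp (- (R\<^sup>2 / (32 * n * v)))
        + (2 * B)\<^sup>2 * exp (- (R / (8 * B)))"
    proof (cases "R / (8 * n * v) \<le> 1 / (2 * B)")
      case True
      then have "l = R / (8 * n * v)" by (simp add: l_def)
      then have "1 / l\<^sup>2 * exp (- (l * R / 4)) = (8 * n * v / R)\<^sup>2 * exp (- (R\<^sup>2 / (32 * n * v)))"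
        by (simp add: power_divide power2_eq_square)
      then show ?thesis by simp
    next
      case False
      then have "l = 1 / (2 * B)" by (simp add: l_def)
      then have "1 / l\<^sup>2 * exp (- (l * R / 4)) = (2 * B)\<^sup>2 * exp (- (R / (8 * B)))"
        by (simp add: power_divide)
      then show ?thesis by simp
    qed
    then show "54 / l\<^sup>2 * exp (- (l * R / 4)) \<le> 54 * ((8 * n * v / R)\<^sup>2 * exp (- (R\<^sup>2 / (32 * n * v)))
        + (2 * B)\<^sup>2 * exp (- (R / (8 * B))))" by simp
  qed
  finally show ?thesis by (simp add: n_def)
qed

end

section \<open>Centering a random square integrable function\<close>

locale L2_vector = prob_space P + N: sigma_finite_measure N
  for P :: "'z measure" and N :: "'x measure" +
  fixes \<phi> :: "'z \<Rightarrow> 'x \<Rightarrow> real" and d :: real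
  assumes \<phi>_measurable [measurable]: "case_prod \<phi> \<in> borel_measurable (P \<Otimes>\<^sub>M N)"
    and \<phi>_L2: "\<And>w. w \<in> space P \<Longrightarrow> \<phi> w \<in> L2 N"
    and \<phi>_pointwise_L2: "\<And>x. x \<in> space N \<Longrightarrow> (\<lambda>w. \<phi> w x) \<in> L2 P"
    and nsq_\<phi>_le: "(\<integral>\<^sup>+w. ennreal (nsq N (\<phi> w)) \<partial>P) \<le> ennreal d"
    and d_nonneg: "0 \<le> d"
begin

sublocale pair_sigma_finite P N ..

text \<open>A pointwise expectation, meaningful at every \<open>x\<close> by
  \<open>\<phi>_pointwise_L2\<close>; no integral with values in a function space is
  involved.\<close>

definition mean :: "'x \<Rightarrow> real" where
  "mean x = (\<integral>w. \<phi> w x \<partial>P)"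

definition dev :: "'z \<Rightarrow> 'x \<Rightarrow> real" where
  "dev w x = \<phi> w x - mean x"

lemma measurable_mean [measurable]: "mean \<in> borel_measurable N"
  unfolding mean_def by measurable

lemma measurable_dev [measurable]: "case_prod dev \<in> borel_measurable (P \<Otimes>\<^sub>M N)"
  unfolding dev_def split_beta' by measurable

text \<open>Both follow from the identity that the variance is the second moment minus the squared
  mean.\<close>

lemma variance_bounds:
  assumes g: "g \<in> L2 P"
  shows "(\<integral>w. g w \<partial>P)\<^sup>2 \<le> nsq P g" "nsq P (\<lambda>w. g w - (\<integral>w. g w \<partial>P)) \<le> nsq P g"
proof -
  define c where "c = (\<integral>w. g w \<partial>P)"
  have one: "(\<lambda>w. - c) \<in> L2 P" by (simp add: L2_def)
  have "nsq P (\<lambda>w. g w + - c) = nsq P g - c\<^sup>2"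
    using nsq_add[OF g one] L2_integrable[OF g]
    by (simp add: nsq_def prob_space c_def[symmetric] power2_eq_square)
  then have eq: "nsq P (\<lambda>w. g w - c) = nsq P g - c\<^sup>2" by simp
  show "(\<integral>w. g w \<partial>P)\<^sup>2 \<le> nsq P g" "nsq P (\<lambda>w. g w - (\<integral>w. g w \<partial>P)) \<le> nsq P g"
    using eq nsq_nonneg[of P "\<lambda>w. g w - c"] by (simp_all add: c_def)
qed

lemma nn_integral_nsq_swap:
  "(\<integral>\<^sup>+x. ennreal (nsq P (\<lambda>w. \<phi> w x)) \<partial>N) = (\<integral>\<^sup>+w. ennreal (nsq N (\<phi> w)) \<partial>P)"
proof -
  have "(\<integral>\<^sup>+x. ennreal (nsq P (\<lambda>w. \<phi> w x)) \<partial>N) = (\<integral>\<^sup>+x. \<integral>\<^sup>+w. ennreal ((\<phi> w x)\<^sup>2) \<partial>P \<partial>N)"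
    using L2_square_integrable[OF \<phi>_pointwise_L2]
    by (intro nn_integral_cong) (simp add: nsq_def nn_integral_eq_integral)
  also have "\<dots> = (\<integral>\<^sup>+w. \<integral>\<^sup>+x. ennreal ((\<phi> w x)\<^sup>2) \<partial>N \<partial>P)"
    by (rule Fubini') measurable
  also have "\<dots> = (\<integral>\<^sup>+w. ennreal (nsq N (\<phi> w)) \<partial>P)"
    using L2_square_integrable[OF \<phi>_L2]
    by (intro nn_integral_cong) (simp add: nsq_def nn_integral_eq_integral)
  finally show ?thesis .
qed

text \<open>Jensen at each \<open>x\<close>, then Tonelli.\<close>

lemma nn_integral_mean_le: "(\<integral>\<^sup>+x. ennreal ((mean x)\<^sup>2) \<partial>N) \<le> (\<integral>\<^sup>+w. ennreal (nsq N (\<phi> w)) \<partial>P)"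
  unfolding nn_integral_nsq_swap[symmetric]
  using variance_bounds(1)[OF \<phi>_pointwise_L2]
  by (intro nn_integral_mono ennreal_leI) (simp add: mean_def)

lemma mean_L2: "mean \<in> L2 N"
proof (rule L2_I)
  show "integrable N (\<lambda>x. (mean x)\<^sup>2)"
  proof (rule integrableI_nonneg)
    show "(\<integral>\<^sup>+x. ennreal ((mean x)\<^sup>2) \<partial>N) < \<infinity>"
      using order_trans[OF nn_integral_mean_le nsq_\<phi>_le] by (rule order_le_less_trans) simp
  qed auto
qed measurable

lemma nsq_mean_le:
  assumes bound: "\<And>w. w \<in> space P \<Longrightarrow> nsq N (\<phi> w) \<le> B"
  shows "nsq N mean \<le> B"
proof -
  obtain w where "w \<in> space P" using not_empty by auto
  from bound[OF this] have B: "0 \<le> B" using nsq_nonneg[of N "\<phi> w"] by simp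
  have "ennreal (nsq N mean) = (\<integral>\<^sup>+x. ennreal ((mean x)\<^sup>2) \<partial>N)"
    by (simp add: nn_integral_eq_integral[OF L2_square_integrable[OF mean_L2]] nsq_def)
  also note nn_integral_mean_le
  also have "(\<integral>\<^sup>+w. ennreal (nsq N (\<phi> w)) \<partial>P) \<le> (\<integral>\<^sup>+w. ennreal B \<partial>P)"
    using bound by (intro nn_integral_mono ennreal_leI)
  also have "\<dots> = ennreal B" by (simp add: emeasure_space_1)
  finally show ?thesis using B by simp
qed

lemma dev_L2: "w \<in> space P \<Longrightarrow> dev w \<in> L2 N"
  unfolding dev_def by (intro L2_diff \<phi>_L2 mean_L2)

text \<open>By Tonelli it suffices to compare at each \<open>x\<close>, where a variance is at most
  the second moment. Hence \<open>d\<close> survives centering without a further constant, which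
  keeps \<open>R\<close> and the penalty threshold small.\<close>

lemma nn_integral_dev_le: "(\<integral>\<^sup>+w. \<integral>\<^sup>+x. ennreal ((dev w x)\<^sup>2) \<partial>N \<partial>P) \<le> ennreal d"
proof -
  have "(\<integral>\<^sup>+w. \<integral>\<^sup>+x. ennreal ((dev w x)\<^sup>2) \<partial>N \<partial>P) = (\<integral>\<^sup>+x. \<integral>\<^sup>+w. ennreal ((dev w x)\<^sup>2) \<partial>P \<partial>N)"
    by (rule Fubini'[symmetric]) measurable
  also have "\<dots> \<le> (\<integral>\<^sup>+x. ennreal (nsq P (\<lambda>w. \<phi> w x)) \<partial>N)"
  proof (rule nn_integral_mono)
    fix x assume x: "x \<in> space N"
    have "(\<lambda>w. dev w x) \<in> L2 P"
      unfolding dev_def by (rule L2_diff[OF \<phi>_pointwise_L2[OF x]]) (simp add: L2_def)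
    then have "(\<integral>\<^sup>+w. ennreal ((dev w x)\<^sup>2) \<partial>P) = ennreal (nsq P (\<lambda>w. dev w x))"
      by (simp add: nsq_def nn_integral_eq_integral[OF L2_square_integrable])
    also have "\<dots> \<le> ennreal (nsq P (\<lambda>w. \<phi> w x))"
      using variance_bounds(2)[OF \<phi>_pointwise_L2[OF x]]
      by (intro ennreal_leI) (simp add: dev_def mean_def)
    finally show "(\<integral>\<^sup>+w. ennreal ((dev w x)\<^sup>2) \<partial>P) \<le> ennreal (nsq P (\<lambda>w. \<phi> w x))" .
  qed
  also have "\<dots> \<le> ennreal d" unfolding nn_integral_nsq_swap by (rule nsq_\<phi>_le)
  finally show ?thesis .
qed

text \<open>Fubini moves the expectation inside, where the deviation at each \<open>x\<close> has
  mean zero. Integrability on the product comes from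
  \<open>\<bar>a * c\<bar> \<le> a^2 + c^2\<close>; the part \<open>u^2\<close> stays finite because
  \<open>P\<close> is a probability measure.\<close>

lemma integral_inner_dev:
  assumes u: "u \<in> L2 N"
  shows "(\<integral>w. (\<integral>x. u x * dev w x \<partial>N) \<partial>P) = 0"
proof -
  note [measurable] = L2_measurable[OF u]
  have int: "integrable (P \<Otimes>\<^sub>M N) (\<lambda>(w, x). u x * dev w x)"
  proof (rule integrableI_bounded)
    have bd: "\<bar>a * c\<bar> \<le> a\<^sup>2 + c\<^sup>2" for a c :: real
      using sum_squares_bound[of "\<bar>a\<bar>" "\<bar>c\<bar>"] abs_ge_zero[of "a * c"]
      unfolding abs_mult power2_abs mult.assoc by linarith
    have "(\<integral>\<^sup>+p. ennreal (norm (case p of (w, x) \<Rightarrow> u x * dev w x)) \<partial>(P \<Otimes>\<^sub>M N))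
      = (\<integral>\<^sup>+w. \<integral>\<^sup>+x. ennreal \<bar>u x * dev w x\<bar> \<partial>N \<partial>P)"
      by (subst N.nn_integral_fst[symmetric]) (auto simp: split_beta')
    also have "\<dots> \<le> (\<integral>\<^sup>+w. \<integral>\<^sup>+x. ennreal ((u x)\<^sup>2) + ennreal ((dev w x)\<^sup>2) \<partial>N \<partial>P)"
      by (intro nn_integral_mono) (simp add: bd ennreal_leI flip: ennreal_plus)
    also have "\<dots> = (\<integral>\<^sup>+w. (\<integral>\<^sup>+x. ennreal ((u x)\<^sup>2) \<partial>N) + (\<integral>\<^sup>+x. ennreal ((dev w x)\<^sup>2) \<partial>N) \<partial>P)"
      by (intro nn_integral_cong nn_integral_add) measurable
    also have "\<dots> = (\<integral>\<^sup>+w. (\<integral>\<^sup>+x. ennreal ((u x)\<^sup>2) \<partial>N) \<partial>P)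
        + (\<integral>\<^sup>+w. (\<integral>\<^sup>+x. ennreal ((dev w x)\<^sup>2) \<partial>N) \<partial>P)"
      by (intro nn_integral_add) measurable
    also have "\<dots> \<le> ennreal (nsq N u) + ennreal d"
      using nn_integral_dev_le L2_square_integrable[OF u]
      by (intro add_mono) (simp_all add: nn_integral_eq_integral emeasure_space_1 nsq_def)
    also have "\<dots> < \<infinity>" by simp
    finally show "(\<integral>\<^sup>+p. ennreal (norm (case p of (w, x) \<Rightarrow> u x * dev w x)) \<partial>(P \<Otimes>\<^sub>M N)) < \<infinity>" .
  qed measurable
  have "(\<integral>w. (\<integral>x. u x * dev w x \<partial>N) \<partial>P) = (\<integral>x. (\<integral>w. u x * dev w x \<partial>P) \<partial>N)"
    by (rule Fubini_integral[OF int, symmetric])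
  also have "\<dots> = (\<integral>x. 0 \<partial>N)"
  proof (rule Bochner_Integration.integral_cong)
    fix x assume "x \<in> space N"
    then show "(\<integral>w. u x * dev w x \<partial>P) = 0"
      using L2_integrable[OF \<phi>_pointwise_L2] by (simp add: dev_def mean_def prob_space)
  qed simp
  finally show ?thesis by simp
qed

sublocale dev: L2_variable P N dev d
proof
  show "(\<integral>\<^sup>+w. ennreal (nsq N (dev w)) \<partial>P) \<le> ennreal d"
  proof -
    have "(\<integral>\<^sup>+w. ennreal (nsq N (dev w)) \<partial>P) = (\<integral>\<^sup>+w. \<integral>\<^sup>+x. ennreal ((dev w x)\<^sup>2) \<partial>N \<partial>P)"
      using L2_square_integrable[OF dev_L2]
      by (intro nn_integral_cong) (simp add: nsq_def nn_integral_eq_integral)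
    then show ?thesis using nn_integral_dev_le by simp
  qed
qed (use dev_L2 integral_inner_dev d_nonneg in auto)

text \<open>The triangle inequality in squared form; the 4 becomes the factor 2 in the bound
  \<open>B\<close> on the norm of the centered truncated summands.\<close>

lemma nsq_dev_le:
  assumes bound: "\<And>w. w \<in> space P \<Longrightarrow> nsq N (\<phi> w) \<le> B" and w: "w \<in> space P"
  shows "nsq N (dev w) \<le> 4 * B"
proof -
  have "nsq N (dev w) \<le> 2 * nsq N (\<phi> w) + 2 * nsq N mean"
    using nsq_add_le[OF \<phi>_L2[OF w] L2_cmult[OF mean_L2, of "-1"]] nsq_cmult[of N "-1" mean]
    by (simp add: dev_def[abs_def])
  then show ?thesis using bound[OF w] nsq_mean_le[OF bound] by simp
qed

text \<open>The inner product with \<open>dev\<close> is the inner product with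
  \<open>\<phi>\<close> minus its expectation, so this is again variance against second
  moment.\<close>

lemma weak_variance_dev_le:
  assumes u: "u \<in> L2 N" and weak: "(\<integral>w. (\<integral>x. u x * \<phi> w x \<partial>N)\<^sup>2 \<partial>P) \<le> c"
  shows "(\<integral>w. (\<integral>x. u x * dev w x \<partial>N)\<^sup>2 \<partial>P) \<le> c"
proof -
  define m where "m = (\<integral>x. u x * mean x \<partial>N)"
  \<comment> \<open>Written through \<open>dev\<close>, for which square integrability of the inner
    product is already available; on \<open>space P\<close> it agrees with the inner product with
    \<open>\<phi>\<close>.\<close>
  define g where "g = (\<lambda>w. (\<integral>x. u x * dev w x \<partial>N) + m)"
  have g: "(\<integral>x. u x * \<phi> w x \<partial>N) = g w" if "w \<in> space P" for w
  proof -
    have "(\<integral>x. u x * dev w x \<partial>N) = (\<integral>x. u x * \<phi> w x - u x * mean x \<partial>N)"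
      by (rule Bochner_Integration.integral_cong) (simp_all add: dev_def algebra_simps)
    also have "\<dots> = (\<integral>x. u x * \<phi> w x \<partial>N) - m"
      using L2_mult_integrable[OF u \<phi>_L2[OF that]] L2_mult_integrable[OF u mean_L2]
      by (simp add: m_def)
    finally show ?thesis by (simp add: g_def)
  qed
  have gL2: "g \<in> L2 P"
    unfolding g_def by (intro L2_add dev.inner_\<xi>_L2[OF u]) (simp add: L2_def)
  have m: "(\<integral>w. g w \<partial>P) = m"
    using integral_inner_dev[OF u] dev.integrable_inner_\<xi>[OF u] by (simp add: g_def prob_space)
  have "(\<integral>w. (\<integral>x. u x * dev w x \<partial>N)\<^sup>2 \<partial>P) = nsq P (\<lambda>w. g w - (\<integral>w. g w \<partial>P))"
    unfolding m by (simp add: nsq_def g_def)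
  also have "\<dots> \<le> nsq P g" by (rule variance_bounds(2)[OF gL2])
  also have "\<dots> = (\<integral>w. (\<integral>x. u x * \<phi> w x \<partial>N)\<^sup>2 \<partial>P)"
    unfolding nsq_def by (rule Bochner_Integration.integral_cong) (simp_all add: g)
  finally show ?thesis using weak by simp
qed

end

section \<open>Convolution\<close>

lemma lborel_reflect:
  fixes g :: "real \<Rightarrow> real"
  shows "integrable lborel (\<lambda>y. g (a - y)) \<longleftrightarrow> integrable lborel g"
    and "(\<integral>y. g (a - y) \<partial>lborel) = (\<integral>y. g y \<partial>lborel)"
  using lborel_integrable_real_affine_iff[of "-1" g a] lborel_integral_real_affine[of "-1" g a]
  by simp_all

lemma L2_reflect: "g \<in> L2 lborel \<Longrightarrow> (\<lambda>y. g (a - y)) \<in> L2 lborel" for g :: "real \<Rightarrow> real"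
  using lborel_reflect(1)[of "\<lambda>y. (g y)\<^sup>2" a] by (auto simp: L2_def)

lemma nsq_reflect: "nsq lborel (\<lambda>y. g (a - y)) = nsq lborel g" for g :: "real \<Rightarrow> real"
  unfolding nsq_def by (rule lborel_reflect(2))

lemma fconv_integrable:
  fixes q g :: "real \<Rightarrow> real"
  assumes "q \<in> L2 lborel" "g \<in> L2 lborel"
  shows "integrable lborel (\<lambda>y. q (x - y) * g y)"
  by (rule L2_mult_integrable[OF L2_reflect]) fact+

lemma fconv_diff:
  assumes "q \<in> L2 lborel" "g \<in> L2 lborel" "h \<in> L2 lborel"
  shows "fconv q (\<lambda>y. g y - h y) x = fconv q g x - fconv q h x"
  using assms by (simp add: fconv_def right_diff_distrib fconv_integrable)

lemma fconv_cmult: "fconv q (\<lambda>y. c * g y) x = c * fconv q g x"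
  by (simp add: fconv_def mult.left_commute)

lemma fconv_sum:
  assumes "q \<in> L2 lborel" "\<And>i. i \<in> I \<Longrightarrow> g i \<in> L2 lborel"
  shows "fconv q (\<lambda>y. \<Sum>i\<in>I. g i y) x = (\<Sum>i\<in>I. fconv q (g i) x)"
  using assms by (simp add: fconv_def sum_distrib_left fconv_integrable)

lemma fconv_square_le:
  assumes "q \<in> L2 lborel" "g \<in> L2 lborel"
  shows "(fconv q g x)\<^sup>2 \<le> nsq lborel q * nsq lborel g"
  using L2_Cauchy_Schwarz[OF L2_reflect[OF assms(1)] assms(2)] by (simp add: fconv_def nsq_reflect)

lemma measurable_fconv [measurable]:
  assumes [measurable]: "q \<in> borel_measurable borel" "g \<in> borel_measurable borel"
  shows "fconv q g \<in> borel_measurable borel"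
  unfolding fconv_def[abs_def] by measurable

text \<open>Cauchy-Schwarz after splitting \<open>\<bar>q\<bar>\<close> into two square roots, then
  Tonelli and translation invariance. The extended integral is used because integrability of the
  squared convolution is only a consequence.\<close>

lemma Young_nn_integral:
  assumes q: "integrable lborel q" "q \<in> L2 lborel" and g: "g \<in> L2 lborel"
  shows "(\<integral>\<^sup>+x. ennreal ((fconv q g x)\<^sup>2) \<partial>lborel)
    \<le> ennreal ((\<integral>x. \<bar>q x\<bar> \<partial>lborel)\<^sup>2 * nsq lborel g)"
proof -
  have [measurable]: "q \<in> borel_measurable borel" "g \<in> borel_measurable borel"
    using L2_measurable[OF g] L2_measurable[OF q(2)] by simp_all
  define k where "k = (\<integral>x. \<bar>q x\<bar> \<partial>lborel)"
  have k: "0 \<le> k" by (simp add: k_def)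
  have q1: "(\<integral>\<^sup>+y. ennreal \<bar>q (x - y)\<bar> \<partial>lborel) = ennreal k" for x
    using q(1) lborel_reflect[of "\<lambda>y. \<bar>q y\<bar>" x] by (subst nn_integral_eq_integral) (simp_all add: k_def)
  have q2: "(\<integral>\<^sup>+x. ennreal \<bar>q (x - y)\<bar> \<partial>lborel) = ennreal k" for y
    using q(1) lborel_integrable_real_affine[of "\<lambda>y. \<bar>q y\<bar>" 1 "-y"]
      lborel_integral_real_affine[of 1 "\<lambda>y. \<bar>q y\<bar>" "-y"]
    by (subst nn_integral_eq_integral) (simp_all add: k_def)
  have "(\<integral>\<^sup>+x. ennreal ((fconv q g x)\<^sup>2) \<partial>lborel)
      \<le> (\<integral>\<^sup>+x. ennreal k * (\<integral>\<^sup>+y. ennreal \<bar>q (x - y)\<bar> * ennreal ((g y)\<^sup>2) \<partial>lborel) \<partial>lborel)"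
  proof (rule nn_integral_mono)
    fix x
    have "ennreal ((fconv q g x)\<^sup>2) = (ennreal \<bar>fconv q g x\<bar>)\<^sup>2"
      by (simp add: ennreal_power)
    also have "ennreal \<bar>fconv q g x\<bar> \<le> (\<integral>\<^sup>+y. ennreal \<bar>q (x - y) * g y\<bar> \<partial>lborel)"
      using integral_norm_bound_ennreal[OF fconv_integrable[OF q(2) g], of x] by (simp add: fconv_def)
    also have "\<dots> = (\<integral>\<^sup>+y. ennreal (sqrt \<bar>q (x - y)\<bar>) * ennreal (sqrt \<bar>q (x - y)\<bar> * \<bar>g y\<bar>) \<partial>lborel)"
      by (intro nn_integral_cong) (simp add: abs_mult flip: ennreal_mult mult.assoc)
    also have "\<dots>\<^sup>2 \<le> (\<integral>\<^sup>+y. (ennreal (sqrt \<bar>q (x - y)\<bar>))\<^sup>2 \<partial>lborel)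
        * (\<integral>\<^sup>+y. (ennreal (sqrt \<bar>q (x - y)\<bar> * \<bar>g y\<bar>))\<^sup>2 \<partial>lborel)"
      by (rule Cauchy_Schwarz_nn_integral) measurable
    also have "(\<integral>\<^sup>+y. (ennreal (sqrt \<bar>q (x - y)\<bar>))\<^sup>2 \<partial>lborel) = ennreal k"
      by (simp add: ennreal_power q1)
    also have "(\<integral>\<^sup>+y. (ennreal (sqrt \<bar>q (x - y)\<bar> * \<bar>g y\<bar>))\<^sup>2 \<partial>lborel)
        = (\<integral>\<^sup>+y. ennreal \<bar>q (x - y)\<bar> * ennreal ((g y)\<^sup>2) \<partial>lborel)"
      by (intro nn_integral_cong) (simp add: ennreal_power power_mult_distrib flip: ennreal_mult)
    finally show "ennreal ((fconv q g x)\<^sup>2)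
        \<le> ennreal k * (\<integral>\<^sup>+y. ennreal \<bar>q (x - y)\<bar> * ennreal ((g y)\<^sup>2) \<partial>lborel)"
      by (simp add: power_mono)
  qed
  also have "\<dots> = ennreal k * (\<integral>\<^sup>+x. (\<integral>\<^sup>+y. ennreal \<bar>q (x - y)\<bar> * ennreal ((g y)\<^sup>2) \<partial>lborel) \<partial>lborel)"
    by (rule nn_integral_cmult) measurable
  also have "(\<integral>\<^sup>+x. (\<integral>\<^sup>+y. ennreal \<bar>q (x - y)\<bar> * ennreal ((g y)\<^sup>2) \<partial>lborel) \<partial>lborel)
      = (\<integral>\<^sup>+y. (\<integral>\<^sup>+x. ennreal \<bar>q (x - y)\<bar> * ennreal ((g y)\<^sup>2) \<partial>lborel) \<partial>lborel)"
    by (rule lborel_pair.Fubini') measurable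
  also have "\<dots> = (\<integral>\<^sup>+y. ennreal k * ennreal ((g y)\<^sup>2) \<partial>lborel)"
    by (intro nn_integral_cong) (simp add: nn_integral_multc q2)
  also have "\<dots> = ennreal k * (\<integral>\<^sup>+y. ennreal ((g y)\<^sup>2) \<partial>lborel)"
    by (rule nn_integral_cmult) measurable
  also have "(\<integral>\<^sup>+y. ennreal ((g y)\<^sup>2) \<partial>lborel) = ennreal (nsq lborel g)"
    unfolding nsq_def by (rule nn_integral_eq_integral[OF L2_square_integrable[OF g]]) simp
  finally show ?thesis
    using k by (simp add: k_def[symmetric] power2_eq_square mult.assoc nsq_nonneg flip: ennreal_mult)
qed

lemma
  assumes q: "integrable lborel q" "q \<in> L2 lborel" and g: "g \<in> L2 lborel"
  shows fconv_L2: "fconv q g \<in> L2 lborel"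
    and Young: "nsq lborel (fconv q g) \<le> (\<integral>x. \<bar>q x\<bar> \<partial>lborel)\<^sup>2 * nsq lborel g"
proof -
  have [measurable]: "q \<in> borel_measurable borel" "g \<in> borel_measurable borel"
    using L2_measurable[OF g] L2_measurable[OF q(2)] by simp_all
  note Y = Young_nn_integral[OF assms]
  have "integrable lborel (\<lambda>x. (fconv q g x)\<^sup>2)"
  proof (rule integrableI_nonneg)
    show "(\<integral>\<^sup>+x. ennreal ((fconv q g x)\<^sup>2) \<partial>lborel) < \<infinity>"
      using Y by (rule order_le_less_trans) simp
  qed simp_all
  then show "fconv q g \<in> L2 lborel" by (auto intro!: L2_I)
  with Y show "nsq lborel (fconv q g) \<le> (\<integral>x. \<bar>q x\<bar> \<partial>lborel)\<^sup>2 * nsq lborel g"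
    by (simp add: nn_integral_eq_integral[OF L2_square_integrable] nsq_def)
qed

text \<open>Substitution \<open>y \<mapsto> x + t - y\<close>. Both interchanges of bandwidths
  below, for the estimators and for their means, reduce to it.\<close>

lemma fconv_commute:
  fixes p q :: "real \<Rightarrow> real"
  shows "(\<integral>y. p (x - y) * q (y - t) \<partial>lborel) = (\<integral>y. q (x - y) * p (y - t) \<partial>lborel)"
  using lborel_reflect(2)[of "\<lambda>y. p (x - y) * q (y - t)" "x + t"] by (simp add: mult.commute)

lemma fconv_fconv_integrable:
  fixes p q g :: "real \<Rightarrow> real"
  assumes p: "p \<in> borel_measurable borel" "\<And>x. \<bar>p x\<bar> \<le> B"
    and q: "integrable lborel q" and g: "integrable lborel g"
  shows "integrable (lborel \<Otimes>\<^sub>M lborel) (\<lambda>(y, t). p (x - y) * q (y - t) * g t)"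
proof (rule integrableI_bounded)
  have [measurable]: "p \<in> borel_measurable borel" "q \<in> borel_measurable borel" "g \<in> borel_measurable borel"
    using p q g by simp_all
  show "(\<lambda>(y, t). p (x - y) * q (y - t) * g t) \<in> borel_measurable (lborel \<Otimes>\<^sub>M lborel)" by measurable
  have B: "0 \<le> B" using p(2)[of 0] by simp
  have q1: "(\<integral>\<^sup>+y. ennreal \<bar>q (y - t)\<bar> \<partial>lborel) = ennreal (\<integral>y. \<bar>q y\<bar> \<partial>lborel)" for t
    using q lborel_integrable_real_affine[of "\<lambda>y. \<bar>q y\<bar>" 1 "-t"]
      lborel_integral_real_affine[of 1 "\<lambda>y. \<bar>q y\<bar>" "-t"]
    by (subst nn_integral_eq_integral) simp_all
  have "(\<integral>\<^sup>+z. ennreal (norm (case z of (y, t) \<Rightarrow> p (x - y) * q (y - t) * g t)) \<partial>(lborel \<Otimes>\<^sub>M lborel))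
      = (\<integral>\<^sup>+t. \<integral>\<^sup>+y. ennreal \<bar>p (x - y) * q (y - t) * g t\<bar> \<partial>lborel \<partial>lborel)"
    by (subst lborel_pair.nn_integral_snd[symmetric]) (auto simp: split_beta')
  also have "\<dots> \<le> (\<integral>\<^sup>+t. \<integral>\<^sup>+y. (ennreal B * ennreal \<bar>g t\<bar>) * ennreal \<bar>q (y - t)\<bar> \<partial>lborel \<partial>lborel)"
  proof (intro nn_integral_mono)
    fix y t :: real
    have "\<bar>p (x - y) * q (y - t) * g t\<bar> \<le> B * \<bar>g t\<bar> * \<bar>q (y - t)\<bar>"
      using mult_right_mono[OF p(2), of "\<bar>g t\<bar> * \<bar>q (y - t)\<bar>" "x - y"]
      by (simp add: abs_mult mult_ac)
    then show "ennreal \<bar>p (x - y) * q (y - t) * g t\<bar> \<le> (ennreal B * ennreal \<bar>g t\<bar>) * ennreal \<bar>q (y - t)\<bar>"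
      using B by (simp add: ennreal_leI flip: ennreal_mult)
  qed
  also have "\<dots> = (\<integral>\<^sup>+t. (ennreal B * ennreal \<bar>g t\<bar>) * ennreal (\<integral>y. \<bar>q y\<bar> \<partial>lborel) \<partial>lborel)"
    by (intro nn_integral_cong) (simp add: nn_integral_cmult q1)
  also have "\<dots> = (ennreal B * (\<integral>\<^sup>+t. ennreal \<bar>g t\<bar> \<partial>lborel)) * ennreal (\<integral>y. \<bar>q y\<bar> \<partial>lborel)"
    by (simp add: nn_integral_multc nn_integral_cmult)
  also have "\<dots> < \<infinity>"
    using g B by (simp add: nn_integral_eq_integral ennreal_mult_less_top flip: ennreal_mult)
  finally show "(\<integral>\<^sup>+z. ennreal (norm (case z of (y, t) \<Rightarrow> p (x - y) * q (y - t) * g t)) \<partial>(lborel \<Otimes>\<^sub>M lborel)) < \<infinity>" .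
qed

text \<open>Fubini reduces both sides to one kernel integrated against \<open>g\<close>, and
  \<open>fconv_commute\<close> identifies the kernels. Fubini is applied once in each order, and
  each time the outer function has to be bounded.\<close>

lemma fconv_fconv_commute:
  assumes p: "integrable lborel p" "\<And>x. \<bar>p x\<bar> \<le> B" and q: "integrable lborel q" "\<And>x. \<bar>q x\<bar> \<le> B'"
    and g: "integrable lborel g"
  shows "fconv p (fconv q g) x = fconv q (fconv p g) x"
proof -
  have *: "fconv p (fconv q g) x = (\<integral>t. (\<integral>y. p (x - y) * q (y - t) \<partial>lborel) * g t \<partial>lborel)"
    if "integrable lborel p" "\<And>x. \<bar>p x\<bar> \<le> B" "integrable lborel q" for p q B
  proof -
    have "fconv p (fconv q g) x = (\<integral>y. (\<integral>t. p (x - y) * q (y - t) * g t \<partial>lborel) \<partial>lborel)"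
      by (simp add: fconv_def mult.assoc)
    also have "\<dots> = (\<integral>t. (\<integral>y. p (x - y) * q (y - t) * g t \<partial>lborel) \<partial>lborel)"
      using that g by (intro lborel_pair.Fubini_integral[symmetric] fconv_fconv_integrable) auto
    finally show ?thesis by simp
  qed
  show ?thesis unfolding *[OF p q(1)] *[OF q p(1)] by (subst fconv_commute) simp
qed

section \<open>The oracle inequality for a fixed sample\<close>

locale kernel =
  fixes K :: "real \<Rightarrow> real"
  assumes K_bounded: "bounded (range K)"
    and K_square_integrable: "integrable lborel (\<lambda>x. (K x)\<^sup>2)"
    and K_integrable: "integrable lborel K"
    and K_integral: "(\<integral>y. K y \<partial>lborel) = 1"
    and K_even: "\<And>x. K (- x) = K x"
begin

lemma K_measurable [measurable]: "K \<in> borel_measurable borel"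
  using borel_measurable_integrable[OF K_integrable] by simp

definition k1 :: real where "k1 = (\<integral>y. \<bar>K y\<bar> \<partial>lborel)"

definition \<kappa> :: real where "\<kappa> = nsq lborel K"

lemma k1_ge_1: "1 \<le> k1"
  using integral_abs_bound[of lborel K] by (simp add: k1_def K_integral)

lemma Lp_norm_1_K: "Lp_norm 1 K = k1"
  using k1_ge_1 by (simp add: Lp_norm_def k1_def)

lemma \<kappa>_pos: "0 < \<kappa>"
proof (rule ccontr)
  assume "\<not> 0 < \<kappa>"
  then have "nsq lborel K = 0"
    using nsq_nonneg[of lborel K] by (simp add: \<kappa>_def)
  then have "(\<integral>y. (K y)\<^sup>2 \<partial>lborel) = 0" by (simp only: nsq_def)
  then have "AE y in lborel. (K y)\<^sup>2 = 0"
    by (subst (asm) integral_nonneg_eq_0_iff_AE[OF K_square_integrable]) auto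
  then have "AE y in lborel. K y = 0" by simp
  then have "(\<integral>y. K y \<partial>lborel) = 0" by (rule integral_eq_zero_AE)
  then show False by (simp add: K_integral)
qed

lemma measurable_scaled [measurable]: "scaled K h \<in> borel_measurable borel"
  unfolding scaled_def[abs_def] by measurable

lemma scaled_even: "scaled K h (- x) = scaled K h x"
  by (simp add: scaled_def K_even)

lemma scaled_minus_commute: "scaled K h (x - y) = scaled K h (y - x)"
  using scaled_even[of h "x - y"] by simp

lemma scaled_bounded: "\<exists>B. \<forall>x. \<bar>scaled K h x\<bar> \<le> B"
proof -
  obtain B where "\<And>x. \<bar>K x\<bar> \<le> B"
    using K_bounded unfolding bounded_iff by auto
  then show ?thesis
    by (intro exI[of _ "\<bar>1 / h\<bar> * B"] allI) (simp add: scaled_def abs_mult divide_right_mono)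
qed

context
  fixes h :: real
  assumes h: "0 < h"
begin

lemma scaled_integrable: "integrable lborel (scaled K h)"
  and scaled_abs_integral: "(\<integral>x. \<bar>scaled K h x\<bar> \<partial>lborel) = k1"
  and scaled_L2: "scaled K h \<in> L2 lborel"
  and nsq_scaled: "nsq lborel (scaled K h) = \<kappa> / h"
proof -
  have K: "integrable lborel (\<lambda>x. K (x / h))" "integrable lborel (\<lambda>x. (K (x / h))\<^sup>2)"
    using lborel_integrable_real_affine[OF K_integrable, of "1 / h" 0]
      lborel_integrable_real_affine[OF K_square_integrable, of "1 / h" 0] h by simp_all
  then show "integrable lborel (scaled K h)"
    by (simp add: scaled_def[abs_def])
  show "(\<integral>x. \<bar>scaled K h x\<bar> \<partial>lborel) = k1"
    using lborel_integral_real_affine[of "1 / h" "\<lambda>y. \<bar>K y\<bar>" 0] h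
    by (simp add: scaled_def k1_def abs_mult)
  show "scaled K h \<in> L2 lborel"
    using K by (auto intro!: L2_I simp: scaled_def[abs_def] power_divide)
  show "nsq lborel (scaled K h) = \<kappa> / h"
    using lborel_integral_real_affine[of "1 / h" "\<lambda>y. (K y)\<^sup>2" 0] h
    by (simp add: scaled_def \<kappa>_def nsq_def power_divide power2_eq_square divide_simps)
qed

lemma fconv_scaled_L2: "g \<in> L2 lborel \<Longrightarrow> fconv (scaled K h) g \<in> L2 lborel"
  by (intro fconv_L2 scaled_integrable scaled_L2)

lemma Young_scaled: "g \<in> L2 lborel \<Longrightarrow> nsq lborel (fconv (scaled K h) g) \<le> k1\<^sup>2 * nsq lborel g"
  using Young[OF scaled_integrable scaled_L2, of g] by (simp add: scaled_abs_integral)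

text \<open>Sup norm bound of order \<open>1 / sqrt h\<close>, in contrast to
  \<open>Young_scaled\<close>, whose constant is free of \<open>h\<close>. The weak variance
  interpolates between the two.\<close>

lemma fconv_scaled_square_le:
  "g \<in> L2 lborel \<Longrightarrow> (fconv (scaled K h) g x)\<^sup>2 \<le> \<kappa> / h * nsq lborel g"
  using fconv_square_le[OF scaled_L2, of g x] by (simp add: nsq_scaled)

end

text \<open>The estimator of a fixed sample with nodes \<open>a\<close> and weights
  \<open>c\<close>, so that the oracle inequality involves no probability; \<open>bf_hat\<close> is
  the case \<open>c i = Y i / n\<close>.\<close>

definition est :: "'i set \<Rightarrow> ('i \<Rightarrow> real) \<Rightarrow> ('i \<Rightarrow> real) \<Rightarrow> real \<Rightarrow> real \<Rightarrow> real" where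
  "est I a c h x = (\<Sum>i\<in>I. c i * scaled K h (a i - x))"

lemma est_L2: "0 < h \<Longrightarrow> est I a c h \<in> L2 lborel"
  unfolding est_def by (intro L2_sum L2_cmult L2_reflect scaled_L2)

text \<open>By evenness each term is a kernel centered at \<open>a i\<close>, so that its smoothing
  is a convolution of two scaled kernels shifted by \<open>a i\<close>, which is symmetric in the
  bandwidths.\<close>

lemma fconv_est_commute:
  assumes "0 < h" "0 < \<eta>"
  shows "fconv (scaled K \<eta>) (est I a c h) x = fconv (scaled K h) (est I a c \<eta>) x"
proof -
  have *: "fconv (scaled K \<eta>) (est I a c h) x
      = (\<Sum>i\<in>I. c i * (\<integral>y. scaled K \<eta> (x - y) * scaled K h (y - a i) \<partial>lborel))"
    if "0 < h" "0 < \<eta>" for h \<eta>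
    unfolding est_def using that
    by (subst fconv_sum) (auto simp: fconv_cmult scaled_L2 L2_cmult L2_reflect,
        simp add: fconv_def scaled_minus_commute[of h])
  show ?thesis unfolding *[OF assms] *[OF assms(2,1)] by (subst fconv_commute) simp
qed

lemma fconv_mean_commute:
  assumes "0 < h" "0 < \<eta>" "integrable lborel g"
  shows "fconv (scaled K \<eta>) (fconv (scaled K h) g) x = fconv (scaled K h) (fconv (scaled K \<eta>) g) x"
proof -
  obtain B B' where "\<And>x. \<bar>scaled K \<eta> x\<bar> \<le> B" "\<And>x. \<bar>scaled K h x\<bar> \<le> B'"
    using scaled_bounded by meson
  then show ?thesis using assms by (intro fconv_fconv_commute scaled_integrable) auto
qed

end

lemma nsq_mono:
  assumes "g \<in> borel_measurable N" "integrable N r" "\<And>x. (g x)\<^sup>2 \<le> r x"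
  shows "nsq N g \<le> (\<integral>x. r x \<partial>N)"
  unfolding nsq_def
proof (rule integral_mono)
  show "integrable N (\<lambda>x. (g x)\<^sup>2)"
    by (rule Bochner_Integration.integrable_bound[OF assms(2)])
      (use assms(1,3) in \<open>auto intro!: AE_I2 intro: order_trans[OF _ abs_ge_self]\<close>)
qed (use assms in auto)

locale kernel_oracle = kernel K for K +
  fixes H :: "real set" and I :: "'i set" and a c :: "'i \<Rightarrow> real" and g :: "real \<Rightarrow> real"
    and V A :: "real \<Rightarrow> real" and hh :: real
  assumes H: "finite H" "\<And>h. h \<in> H \<Longrightarrow> 0 < h"
    and g: "g \<in> L2 lborel" "integrable lborel g"
    and V: "\<And>h. h \<in> H \<Longrightarrow> 0 \<le> V h"
    and A: "\<And>h. h \<in> H \<Longrightarrow> A h = (SUP \<eta>\<in>H. max 0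
      (nsq lborel (\<lambda>x. fconv (scaled K \<eta>) (est I a c h) x - est I a c \<eta> x) - V \<eta>))"
    and hh: "is_arg_min (\<lambda>h. A h + V h) (\<lambda>h. h \<in> H) hh"
begin

abbreviation F :: "real \<Rightarrow> real \<Rightarrow> real" where "F \<equiv> est I a c"
abbreviation \<mu> :: "real \<Rightarrow> real \<Rightarrow> real" where "\<mu> h \<equiv> fconv (scaled K h) g"
definition bias :: "real \<Rightarrow> real" where "bias h = nsq lborel (\<lambda>x. \<mu> h x - g x)"
text \<open>A sum rather than a maximum over \<open>H\<close>, so that expectations can be taken
  term by term. The divisor \<open>8 * k1^2\<close> is the factor of the deviation in
  \<open>comparison_le\<close>; multiplied back, it restores exactly the \<open>V \<eta>\<close>
  that is subtracted in \<open>A\<close>.\<close>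

definition excess :: real where
  "excess = (\<Sum>\<eta>\<in>H. max 0 (nsq lborel (\<lambda>x. F \<eta> x - \<mu> \<eta> x) - V \<eta> / (8 * k1\<^sup>2)))"

lemma nsq_deviation_le:
  assumes "\<eta> \<in> H"
  shows "nsq lborel (\<lambda>x. F \<eta> x - \<mu> \<eta> x) \<le> excess + V \<eta> / (8 * k1\<^sup>2)"
proof -
  have "max 0 (nsq lborel (\<lambda>x. F \<eta> x - \<mu> \<eta> x) - V \<eta> / (8 * k1\<^sup>2)) \<le> excess"
    unfolding excess_def using assms H(1)
    by (intro member_le_sum[of \<eta> H]) auto
  then show ?thesis by linarith
qed

text \<open>Since both double smoothings commute, the difference equals \<open>K_h * (F \<eta> -
  \<mu> \<eta>) + K_\<eta> * (\<mu> h - g) - (F \<eta> - \<mu> \<eta>)\<close>. The deviation at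
  \<open>h\<close>, which \<open>V \<eta>\<close> could not absorb, does not occur.\<close>

lemma comparison_le:
  assumes "h \<in> H" "\<eta> \<in> H"
  shows "nsq lborel (\<lambda>x. fconv (scaled K \<eta>) (F h) x - F \<eta> x)
    \<le> 8 * k1\<^sup>2 * nsq lborel (\<lambda>x. F \<eta> x - \<mu> \<eta> x) + 2 * k1\<^sup>2 * bias h"
proof -
  have pos: "0 < h" "0 < \<eta>" using assms H by auto
  note L = est_L2[OF pos(1), of I a c] est_L2[OF pos(2), of I a c] fconv_scaled_L2[OF pos(1) g(1)]
    fconv_scaled_L2[OF pos(2) g(1)] g(1)
  define p where "p = (\<lambda>x. F \<eta> x - \<mu> \<eta> x)"
  define q where "q = (\<lambda>x. \<mu> h x - g x)"
  have pq: "p \<in> L2 lborel" "q \<in> L2 lborel" unfolding p_def q_def by (intro L2_diff L)+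
  have eq: "fconv (scaled K \<eta>) (F h) x - F \<eta> x
      = fconv (scaled K h) p x + fconv (scaled K \<eta>) q x - p x" for x
    unfolding p_def q_def fconv_diff[OF scaled_L2[OF pos(1)] L(2,4)] fconv_diff[OF scaled_L2[OF pos(2)] L(3,5)]
      fconv_est_commute[OF pos] fconv_mean_commute[OF pos g(2)]
    by simp
  \<comment> \<open>The two deviation terms get weight 4 each, and Young's inequality with
    \<open>1 \<le> k1\<close> makes them \<open>8 * k1^2\<close> together.\<close>
  have "(s + t - r)\<^sup>2 \<le> 4 * s\<^sup>2 + 2 * t\<^sup>2 + 4 * r\<^sup>2" for s t r :: real
    using sum_squares_bound[of "s - r" t] zero_le_power2[of "s + r"]
    by (simp add: power2_eq_square algebra_simps)
  then have "nsq lborel (\<lambda>x. fconv (scaled K h) p x + fconv (scaled K \<eta>) q x - p x)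
    \<le> (\<integral>x. 4 * (fconv (scaled K h) p x)\<^sup>2 + 2 * (fconv (scaled K \<eta>) q x)\<^sup>2 + 4 * (p x)\<^sup>2 \<partial>lborel)"
    using fconv_scaled_L2[OF pos(1) pq(1)] fconv_scaled_L2[OF pos(2) pq(2)] pq
    by (intro nsq_mono) (auto simp: L2_def)
  also have "\<dots> = 4 * nsq lborel (fconv (scaled K h) p) + 2 * nsq lborel (fconv (scaled K \<eta>) q)
      + 4 * nsq lborel p"
    using fconv_scaled_L2[OF pos(1) pq(1)] fconv_scaled_L2[OF pos(2) pq(2)] pq
    by (simp add: L2_def nsq_def)
  also have "\<dots> \<le> 4 * (k1\<^sup>2 * nsq lborel p) + 2 * (k1\<^sup>2 * nsq lborel q) + 4 * (k1\<^sup>2 * nsq lborel p)"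
  proof (intro add_mono mult_left_mono Young_scaled pos pq)
    have "1 * nsq lborel p \<le> k1\<^sup>2 * nsq lborel p"
      using k1_ge_1 by (intro mult_right_mono nsq_nonneg) (simp add: one_le_power)
    then show "nsq lborel p \<le> k1\<^sup>2 * nsq lborel p" by simp
  qed auto
  finally show ?thesis by (simp add: eq bias_def p_def q_def)
qed

lemma A_le:
  assumes h: "h \<in> H"
  shows "A h \<le> 8 * k1\<^sup>2 * excess + 2 * k1\<^sup>2 * bias h"
  unfolding A[OF h]
proof (rule cSUP_least)
  show "H \<noteq> {}" using h by auto
  fix \<eta> assume \<eta>: "\<eta> \<in> H"
  have ex: "0 \<le> excess" unfolding excess_def by (intro sum_nonneg) auto
  have k: "0 < k1" using k1_ge_1 by simp
  have "8 * k1\<^sup>2 * nsq lborel (\<lambda>x. F \<eta> x - \<mu> \<eta> x) \<le> 8 * k1\<^sup>2 * (excess + V \<eta> / (8 * k1\<^sup>2))"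
    by (intro mult_left_mono nsq_deviation_le \<eta>) auto
  also have "\<dots> = 8 * k1\<^sup>2 * excess + V \<eta>" using k by (simp add: field_simps)
  finally show "max 0 (nsq lborel (\<lambda>x. fconv (scaled K \<eta>) (F h) x - F \<eta> x) - V \<eta>)
      \<le> 8 * k1\<^sup>2 * excess + 2 * k1\<^sup>2 * bias h"
    using comparison_le[OF h \<eta>] ex by (simp add: bias_def nsq_nonneg)
qed

lemma comparison_le_A:
  assumes "h \<in> H" "\<eta> \<in> H"
  shows "nsq lborel (\<lambda>x. fconv (scaled K \<eta>) (F h) x - F \<eta> x) \<le> A h + V \<eta>"
proof -
  have "max 0 (nsq lborel (\<lambda>x. fconv (scaled K \<eta>) (F h) x - F \<eta> x) - V \<eta>) \<le> A h"
    unfolding A[OF assms(1)] using assms H(1) by (intro cSUP_upper) auto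
  then show ?thesis by linarith
qed

text \<open>The way from \<open>F hh\<close> to \<open>g\<close> leads over the doubly smoothed
  \<open>p\<close>, then \<open>F h\<close> and \<open>\<mu> h\<close>. As \<open>p\<close> arises
  from either estimator, its two gaps are at most \<open>A h + V hh\<close> and
  \<open>A hh + V h\<close>; their sum regroups into the criterion at \<open>h\<close> and at
  \<open>hh\<close>, and minimality removes \<open>hh\<close>.\<close>

lemma oracle_inequality:
  assumes h: "h \<in> H"
  shows "nsq lborel (\<lambda>x. F hh x - g x)
    \<le> (12 * k1\<^sup>2 + 6) * bias h + 12 * V h + (48 * k1\<^sup>2 + 6) * excess"
proof -
  have hH: "hh \<in> H" and min: "A hh + V hh \<le> A h + V h"
    using hh h by (auto simp: is_arg_min_def not_less)
  have pos: "0 < h" "0 < hh" using h hH H by auto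
  note L = est_L2[OF pos(1), of I a c] est_L2[OF pos(2), of I a c] fconv_scaled_L2[OF pos(1) g(1)] g(1)
  define p where "p = fconv (scaled K hh) (F h)"
  have p: "p \<in> L2 lborel" unfolding p_def by (rule fconv_scaled_L2[OF pos(2) L(1)])
  have p': "p = fconv (scaled K h) (F hh)" unfolding p_def by (rule ext) (rule fconv_est_commute[OF pos])
  \<comment> \<open>Three gaps with weight 3; the last one is split once more at \<open>m\<close>,
    which doubles its weight.\<close>
  have "(s - g)\<^sup>2 \<le> 3 * (p - s)\<^sup>2 + 3 * (p - t)\<^sup>2 + 6 * (t - m)\<^sup>2 + 6 * (m - g)\<^sup>2" for s t p m g :: real
  proof -
    have "(r + u + v)\<^sup>2 \<le> 3 * r\<^sup>2 + 3 * u\<^sup>2 + 3 * v\<^sup>2" for r u v :: real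
      using zero_le_power2[of "r - u"] zero_le_power2[of "r - v"] zero_le_power2[of "u - v"]
      by (simp add: power2_eq_square algebra_simps)
    from this[of "s - p" "p - t" "t - g"]
    have "(s - g)\<^sup>2 \<le> 3 * (p - s)\<^sup>2 + 3 * (p - t)\<^sup>2 + 3 * (t - g)\<^sup>2" by (simp add: power2_commute)
    moreover have "(t - g)\<^sup>2 \<le> 2 * (t - m)\<^sup>2 + 2 * (m - g)\<^sup>2"
      using sum_squares_bound[of "t - m" "m - g"] by (simp add: power2_eq_square algebra_simps)
    ultimately show ?thesis by linarith
  qed
  then have "nsq lborel (\<lambda>x. F hh x - g x) \<le> (\<integral>x. 3 * (p x - F hh x)\<^sup>2 + 3 * (p x - F h x)\<^sup>2
      + 6 * (F h x - \<mu> h x)\<^sup>2 + 6 * (\<mu> h x - g x)\<^sup>2 \<partial>lborel)"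
    using L2_diff[OF p L(2)] L2_diff[OF p L(1)] L2_diff[OF L(1,3)] L2_diff[OF L(3,4)] L2_diff[OF L(2,4)]
    by (intro nsq_mono) (auto simp: L2_def)
  also have "\<dots> = 3 * nsq lborel (\<lambda>x. p x - F hh x) + 3 * nsq lborel (\<lambda>x. p x - F h x)
      + 6 * nsq lborel (\<lambda>x. F h x - \<mu> h x) + 6 * bias h"
    using L2_diff[OF p L(2)] L2_diff[OF p L(1)] L2_diff[OF L(1,3)] L2_diff[OF L(3,4)]
    by (simp add: L2_def nsq_def bias_def)
  also have "\<dots> \<le> 3 * (A h + V hh) + 3 * (A hh + V h) + 6 * (excess + V h) + 6 * bias h"
  proof (intro add_mono mult_left_mono order_refl)
    show "nsq lborel (\<lambda>x. p x - F hh x) \<le> A h + V hh"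
      unfolding p_def by (rule comparison_le_A[OF h hH])
    show "nsq lborel (\<lambda>x. p x - F h x) \<le> A hh + V h"
      unfolding p' by (rule comparison_le_A[OF hH h])
    have "V h * 1 \<le> V h * (8 * k1\<^sup>2)"
      using V[OF h] one_le_power[OF k1_ge_1, of 2] by (intro mult_left_mono) auto
    then have "V h / (8 * k1\<^sup>2) \<le> V h"
      using k1_ge_1 by (simp add: field_simps)
    then show "nsq lborel (\<lambda>x. F h x - \<mu> h x) \<le> excess + V h"
      using nsq_deviation_le[OF h] by simp
  qed auto
  also have "\<dots> \<le> 6 * A h + 12 * V h + 6 * excess + 6 * bias h" using min by simp
  also have "\<dots> \<le> 6 * (8 * k1\<^sup>2 * excess + 2 * k1\<^sup>2 * bias h) + 12 * V h + 6 * excess + 6 * bias h"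
    using A_le[OF h] by simp
  also have "\<dots> = (12 * k1\<^sup>2 + 6) * bias h + 12 * V h + (48 * k1\<^sup>2 + 6) * excess"
    by (simp add: algebra_simps)
  finally show ?thesis .
qed

end

section \<open>The sample as an i.i.d. sequence of pairs\<close>

lemma restrict_vimage_prod_emb:
  assumes "J \<noteq> {}" "J \<subseteq> I" "\<And>i. i \<in> I \<Longrightarrow> Y i \<in> M \<rightarrow>\<^sub>M N i"
  shows "(\<lambda>\<omega>. \<lambda>i\<in>I. Y i \<omega>) -` prod_emb I N J (PiE J D) \<inter> space M = (\<Inter>j\<in>J. Y j -` D j \<inter> space M)"
  using assms measurable_space[OF assms(3)]
  by (auto simp: prod_emb_def PiE_iff subset_iff)

context prob_space
begin

lemma indep_var_component:
  assumes XE: "indep_var (PiM I MX) (\<lambda>\<omega>. \<lambda>i\<in>I. X i \<omega>) (PiM I ME) (\<lambda>\<omega>. \<lambda>i\<in>I. E i \<omega>)"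
    and i: "i \<in> I"
  shows "indep_var (MX i) (X i) (ME i) (E i)"
  using indep_var_compose[OF XE measurable_component_singleton[OF i] measurable_component_singleton[OF i]] i
  by (simp add: comp_def)

text \<open>Preimages of rectangles are stable under intersection and generate the preimages of the
  product sigma algebra, so it suffices to factor the probabilities of such events. Independence of
  the two sequences separates \<open>X\<close> from \<open>E\<close>, independence within each
  sequence separates the indices, and the factors are regrouped by index.\<close>

lemma indep_vars_Pair:
  assumes X: "indep_vars MX X I" and E: "indep_vars ME E I"
    and XE: "indep_var (PiM I MX) (\<lambda>\<omega>. \<lambda>i\<in>I. X i \<omega>) (PiM I ME) (\<lambda>\<omega>. \<lambda>i\<in>I. E i \<omega>)"
  shows "indep_vars (\<lambda>i. MX i \<Otimes>\<^sub>M ME i) (\<lambda>i \<omega>. (X i \<omega>, E i \<omega>)) I"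
  unfolding indep_vars_def2
proof (intro conjI ballI)
  have rv: "random_variable (MX i) (X i)" "random_variable (ME i) (E i)" if "i \<in> I" for i
    using X E that by (auto simp: indep_vars_def2)
  then show "random_variable (MX i \<Otimes>\<^sub>M ME i) (\<lambda>\<omega>. (X i \<omega>, E i \<omega>))" if "i \<in> I" for i
    using that by simp
  define G where "G = (\<lambda>i. {(\<lambda>\<omega>. (X i \<omega>, E i \<omega>)) -` (A \<times> B) \<inter> space M | A B. A \<in> sets (MX i) \<and> B \<in> sets (ME i)})"
  have "indep_sets G I"
  proof (rule indep_setsI)
    show "G i \<subseteq> events" if "i \<in> I" for i
      unfolding G_def using rv[OF that] by (auto intro!: measurable_sets[of _ M "MX i \<Otimes>\<^sub>M ME i"])
    fix C J assume J: "J \<noteq> {}" "J \<subseteq> I" "finite J" and CG: "\<forall>j\<in>J. C j \<in> G j"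
    have "\<forall>j\<in>J. \<exists>A B. A \<in> sets (MX j) \<and> B \<in> sets (ME j)
        \<and> C j = (\<lambda>\<omega>. (X j \<omega>, E j \<omega>)) -` (A \<times> B) \<inter> space M"
    proof
      fix j assume "j \<in> J"
      with CG have "C j \<in> G j" by simp
      then show "\<exists>A B. A \<in> sets (MX j) \<and> B \<in> sets (ME j) \<and> C j = (\<lambda>\<omega>. (X j \<omega>, E j \<omega>)) -` (A \<times> B) \<inter> space M"
        unfolding G_def by blast
    qed
    from bchoice[OF this] obtain A where "\<forall>j\<in>J. \<exists>B. A j \<in> sets (MX j) \<and> B \<in> sets (ME j)
        \<and> C j = (\<lambda>\<omega>. (X j \<omega>, E j \<omega>)) -` (A j \<times> B) \<inter> space M" ..
    from bchoice[OF this] obtain B where AB_all: "\<forall>j\<in>J. A j \<in> sets (MX j) \<and> B j \<in> sets (ME j)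
        \<and> C j = (\<lambda>\<omega>. (X j \<omega>, E j \<omega>)) -` (A j \<times> B j) \<inter> space M" ..
    then have AB: "\<And>j. j \<in> J \<Longrightarrow> A j \<in> sets (MX j)" "\<And>j. j \<in> J \<Longrightarrow> B j \<in> sets (ME j)"
      and C: "\<And>j. j \<in> J \<Longrightarrow> C j = (\<lambda>\<omega>. (X j \<omega>, E j \<omega>)) -` (A j \<times> B j) \<inter> space M"
      by simp_all
    have prod_C: "prob (C j) = prob (X j -` A j \<inter> space M) * prob (E j -` B j \<inter> space M)" if j: "j \<in> J" for j
      unfolding C[OF j]
      by (rule indep_varD[OF indep_var_component[OF XE subsetD[OF J(2) j]] AB(1)[OF j] AB(2)[OF j]])
    \<comment> \<open>Only the whole sequences are assumed independent of each other, so the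
      finitely many constraints are written as cylinder sets in sequence space.\<close>
    define SX where "SX = prod_emb I MX J (PiE J A)"
    define SE where "SE = prod_emb I ME J (PiE J B)"
    have sets: "SX \<in> sets (PiM I MX)" "SE \<in> sets (PiM I ME)"
      unfolding SX_def SE_def using J AB by (auto intro!: sets_PiM_I)
    have vim: "(\<lambda>\<omega>. \<lambda>i\<in>I. X i \<omega>) -` SX \<inter> space M = (\<Inter>j\<in>J. X j -` A j \<inter> space M)"
      "(\<lambda>\<omega>. \<lambda>i\<in>I. E i \<omega>) -` SE \<inter> space M = (\<Inter>j\<in>J. E j -` B j \<inter> space M)"
      unfolding SX_def SE_def
      using restrict_vimage_prod_emb[where Y = X and D = A, OF J(1,2) rv(1)]
        restrict_vimage_prod_emb[where Y = E and D = B, OF J(1,2) rv(2)] by simp_all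
    have "(\<Inter>j\<in>J. C j) = (\<lambda>\<omega>. (\<lambda>i\<in>I. X i \<omega>, \<lambda>i\<in>I. E i \<omega>)) -` (SX \<times> SE) \<inter> space M"
    proof -
      have "(\<lambda>\<omega>. (\<lambda>i\<in>I. X i \<omega>, \<lambda>i\<in>I. E i \<omega>)) -` (SX \<times> SE) \<inter> space M
        = ((\<lambda>\<omega>. \<lambda>i\<in>I. X i \<omega>) -` SX \<inter> space M) \<inter> ((\<lambda>\<omega>. \<lambda>i\<in>I. E i \<omega>) -` SE \<inter> space M)"
        by auto
      then show ?thesis unfolding vim using C J(1) by auto
    qed
    then have "prob (\<Inter>j\<in>J. C j) = prob (\<Inter>j\<in>J. X j -` A j \<inter> space M) * prob (\<Inter>j\<in>J. E j -` B j \<inter> space M)"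
      by (simp only: indep_varD[OF XE sets] vim)
    also have "\<dots> = (\<Prod>j\<in>J. prob (X j -` A j \<inter> space M)) * (\<Prod>j\<in>J. prob (E j -` B j \<inter> space M))"
      using J AB by (simp only: indep_varsD[OF X J(1,3,2)] indep_varsD[OF E J(1,3,2)])
    also have "\<dots> = (\<Prod>j\<in>J. prob (C j))"
      unfolding prod.distrib[symmetric] by (rule prod.cong) (simp_all add: prod_C)
    finally show "prob (\<Inter>j\<in>J. C j) = (\<Prod>j\<in>J. prob (C j))" .
  qed
  moreover have "Int_stable (G i)" if "i \<in> I" for i
  proof (rule Int_stableI)
    fix C D assume "C \<in> G i" "D \<in> G i"
    then obtain A B A' B' where AB: "A \<in> sets (MX i)" "B \<in> sets (ME i)" "A' \<in> sets (MX i)" "B' \<in> sets (ME i)"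
      and CD: "C = (\<lambda>\<omega>. (X i \<omega>, E i \<omega>)) -` (A \<times> B) \<inter> space M" "D = (\<lambda>\<omega>. (X i \<omega>, E i \<omega>)) -` (A' \<times> B') \<inter> space M"
      by (auto simp: G_def)
    have "C \<inter> D = (\<lambda>\<omega>. (X i \<omega>, E i \<omega>)) -` ((A \<inter> A') \<times> (B \<inter> B')) \<inter> space M"
      unfolding CD by auto
    then show "C \<inter> D \<in> G i" unfolding G_def using AB by blast
  qed
  ultimately have "indep_sets (\<lambda>i. sigma_sets (space M) (G i)) I"
    by (rule indep_sets_sigma)
  then show "indep_sets (\<lambda>i. {(\<lambda>\<omega>. (X i \<omega>, E i \<omega>)) -` A \<inter> space M |A. A \<in> sets (MX i \<Otimes>\<^sub>M ME i)}) I"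
  proof (rule indep_sets_mono_sets)
    fix i assume i: "i \<in> I"
    let ?Z = "\<lambda>\<omega>. (X i \<omega>, E i \<omega>)" and ?R = "{a \<times> b |a b. a \<in> sets (MX i) \<and> b \<in> sets (ME i)}"
    have "?Z \<in> space M \<rightarrow> space (MX i) \<times> space (ME i)"
      using rv[OF i] by (auto dest: measurable_space)
    from sigma_sets_vimage_commute[OF this, of ?R]
    have "{?Z -` A \<inter> space M |A. A \<in> sets (MX i \<Otimes>\<^sub>M ME i)}
        = sigma_sets (space M) {?Z -` A \<inter> space M |A. A \<in> ?R}"
      unfolding sets_pair_measure .
    also have "{?Z -` A \<inter> space M |A. A \<in> ?R} = G i"
      unfolding G_def by blast
    finally show "{?Z -` A \<inter> space M |A. A \<in> sets (MX i \<Otimes>\<^sub>M ME i)} \<subseteq> sigma_sets (space M) (G i)"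
      by simp
  qed
qed

end

section \<open>The common law of the observed pairs\<close>

context regression_model
begin

abbreviation Y :: "nat \<Rightarrow> 'a \<Rightarrow> real" where "Y \<equiv> response b X \<epsilon>"

definition P :: "(real \<times> real) measure" where
  "P = distr M (borel \<Otimes>\<^sub>M borel) (\<lambda>\<omega>. (X 1 \<omega>, Y 1 \<omega>))"

lemma sets_P [measurable_cong, simp]: "sets P = sets (borel \<Otimes>\<^sub>M borel)"
  by (simp add: P_def)

lemma space_P [simp]: "space P = UNIV"
  by (simp add: P_def space_pair_measure)

lemma X_measurable: "1 \<le> i \<Longrightarrow> X i \<in> borel_measurable M"
  using X_indep by (auto simp: indep_vars_def2)

lemma \<epsilon>_measurable: "1 \<le> i \<Longrightarrow> \<epsilon> i \<in> borel_measurable M"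
  using eps_indep by (auto simp: indep_vars_def2)

lemma Y_measurable: "1 \<le> i \<Longrightarrow> Y i \<in> borel_measurable M"
  using X_measurable[of i] \<epsilon>_measurable[of i] b_measurable by (simp add: response_def[abs_def])

lemma XY_measurable: "1 \<le> i \<Longrightarrow> (\<lambda>\<omega>. (X i \<omega>, Y i \<omega>)) \<in> M \<rightarrow>\<^sub>M borel \<Otimes>\<^sub>M borel"
  using X_measurable[of i] Y_measurable[of i] by simp

lemma distr_X: "1 \<le> i \<Longrightarrow> distr M borel (X i) = density lborel (\<lambda>x. ennreal (f x))"
  using X_density[of i] by (simp add: distributed_def cong: distr_cong)

lemma indep_X_\<epsilon>: "1 \<le> i \<Longrightarrow> indep_var borel (X i) borel (\<epsilon> i)"
  using indep_var_component[OF X_eps_indep, of i] by simp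

lemma to_response_measurable:
  "(\<lambda>(x, e). (x, b x + e)) \<in> (borel :: real measure) \<Otimes>\<^sub>M (borel :: real measure) \<rightarrow>\<^sub>M borel \<Otimes>\<^sub>M borel"
  using b_measurable by measurable

text \<open>By independence the law of \<open>(X i, \<epsilon> i)\<close> is a product whose factors
  do not depend on \<open>i\<close>, and \<open>(x, e) \<mapsto> (x, b x + e)\<close> carries it to
  the law of the observed pair.\<close>

lemma distr_XY: "1 \<le> i \<Longrightarrow> distr M (borel \<Otimes>\<^sub>M borel) (\<lambda>\<omega>. (X i \<omega>, Y i \<omega>)) = P"
proof -
  have *: "distr M (borel \<Otimes>\<^sub>M borel) (\<lambda>\<omega>. (X i \<omega>, Y i \<omega>))
      = distr (density lborel (\<lambda>x. ennreal (f x)) \<Otimes>\<^sub>M distr M borel (\<epsilon> 1)) (borel \<Otimes>\<^sub>M borel) (\<lambda>(x, e). (x, b x + e))"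
    if i: "1 \<le> i" for i
  proof -
    have "distr M borel (X i) \<Otimes>\<^sub>M distr M borel (\<epsilon> i) = distr M (borel \<Otimes>\<^sub>M borel) (\<lambda>\<omega>. (X i \<omega>, \<epsilon> i \<omega>))"
      using indep_X_\<epsilon>[OF i] unfolding indep_var_distribution_eq by simp
    then show ?thesis
      using X_measurable[OF i] \<epsilon>_measurable[OF i]
      by (simp add: distr_X[OF i] eps_identical[OF i] distr_distr[OF to_response_measurable] comp_def response_def)
  qed
  show "1 \<le> i \<Longrightarrow> ?thesis" unfolding P_def by (subst (1 2) *) simp_all
qed

text \<open>Transfers integrals over the sample to a product measure, where the inductions over the
  index set take place.\<close>

lemma distr_sample:
  assumes I: "I \<noteq> {}" "I \<subseteq> {1..}"
  shows "distr M (PiM I (\<lambda>_. borel \<Otimes>\<^sub>M borel)) (\<lambda>\<omega>. \<lambda>i\<in>I. (X i \<omega>, Y i \<omega>)) = PiM I (\<lambda>_. P)"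
proof -
  have "indep_vars (\<lambda>_. borel \<Otimes>\<^sub>M borel) (\<lambda>i \<omega>. (X i \<omega>, \<epsilon> i \<omega>)) {1..}"
    by (rule indep_vars_Pair[OF X_indep eps_indep X_eps_indep])
  then have "indep_vars (\<lambda>_. borel \<Otimes>\<^sub>M borel) (\<lambda>i \<omega>. (\<lambda>(x, e). (x, b x + e)) (X i \<omega>, \<epsilon> i \<omega>)) {1..}"
    by (rule indep_vars_compose2) (rule to_response_measurable)
  then have "indep_vars (\<lambda>_. borel \<Otimes>\<^sub>M borel) (\<lambda>i \<omega>. (X i \<omega>, Y i \<omega>)) I"
    using I(2) by (simp add: response_def indep_vars_subset)
  then have "distr M (PiM I (\<lambda>_. borel \<Otimes>\<^sub>M borel)) (\<lambda>\<omega>. \<lambda>i\<in>I. (X i \<omega>, Y i \<omega>))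
      = PiM I (\<lambda>i. distr M (borel \<Otimes>\<^sub>M borel) (\<lambda>\<omega>. (X i \<omega>, Y i \<omega>)))"
    using I XY_measurable by (subst (asm) indep_vars_iff_distr_eq_PiM') auto
  also have "\<dots> = PiM I (\<lambda>_. P)"
    using I(2) by (intro PiM_cong refl distr_XY) auto
  finally show ?thesis .
qed

end

section \<open>Moments, weak variance and mean of a single kernel summand\<close>

locale kernel_regression = regression_model M X \<epsilon> b f \<sigma> + kernel K
  for M :: "'a measure" and X \<epsilon> b f \<sigma> and K :: "real \<Rightarrow> real" +
  fixes fb :: real
  assumes f_le: "\<And>x. f x \<le> fb" and fb_pos: "0 < fb"
    and Y6: "integrable M (\<lambda>\<omega>. (Y 1 \<omega>) ^ 6)"
begin

definition s2 :: real where "s2 = (\<integral>\<omega>. (Y 1 \<omega>)\<^sup>2 \<partial>M)"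
definition s4 :: real where "s4 = (\<integral>\<omega>. (Y 1 \<omega>) ^ 4 \<partial>M)"

sublocale P: prob_space P
  unfolding P_def by (rule prob_space_distr[OF XY_measurable]) simp

lemma Y_moments: "integrable M (\<lambda>\<omega>. (Y 1 \<omega>)\<^sup>2)" "integrable M (\<lambda>\<omega>. (Y 1 \<omega>) ^ 4)"
proof -
  note [measurable] = Y_measurable[of 1, simplified]
  have int: "integrable M (\<lambda>\<omega>. 1 + (Y 1 \<omega>) ^ 6)" using Y6 by simp
  have y: "y\<^sup>2 \<le> 1 + y ^ 6" "y ^ 4 \<le> 1 + y ^ 6" for y :: real
  proof -
    define t where "t = y\<^sup>2"
    have t: "0 \<le> t" "y ^ 4 = t\<^sup>2" "y ^ 6 = t ^ 3"
      by (simp_all add: t_def flip: power_mult)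
    have "t \<le> 1 + t ^ 3 \<and> t\<^sup>2 \<le> 1 + t ^ 3"
    proof (cases "t \<le> 1")
      case True
      then have "t\<^sup>2 \<le> 1" "0 \<le> t ^ 3" using t by (simp_all add: power_le_one)
      then show ?thesis using True by linarith
    next
      case False
      then have "t ^ 1 \<le> t ^ 3" "t ^ 2 \<le> t ^ 3" by (intro power_increasing; simp)+
      then show ?thesis by simp
    qed
    then show "y\<^sup>2 \<le> 1 + y ^ 6" "y ^ 4 \<le> 1 + y ^ 6" by (auto simp: t simp flip: t_def)
  qed
  show "integrable M (\<lambda>\<omega>. (Y 1 \<omega>)\<^sup>2)" "integrable M (\<lambda>\<omega>. (Y 1 \<omega>) ^ 4)"
    by (rule Bochner_Integration.integrable_bound[OF int];
        use y in \<open>auto intro!: AE_I2 intro: order_trans[OF _ abs_ge_self]\<close>)+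
qed

lemma L2_M: "Y 1 \<in> L2 M" "\<epsilon> 1 \<in> L2 M" "(\<lambda>\<omega>. b (X 1 \<omega>)) \<in> L2 M"
proof -
  show Y: "Y 1 \<in> L2 M" using Y_moments(1) Y_measurable[of 1] by (simp add: L2_def)
  show e: "\<epsilon> 1 \<in> L2 M" using eps_integrable(2) \<epsilon>_measurable[of 1] by (simp add: L2_def)
  show "(\<lambda>\<omega>. b (X 1 \<omega>)) \<in> L2 M" using L2_diff[OF Y e] by (simp add: response_def)
qed

lemma
  assumes [measurable]: "g \<in> borel_measurable borel"
  shows integrable_X_iff: "integrable M (\<lambda>\<omega>. g (X 1 \<omega>)) \<longleftrightarrow> integrable lborel (\<lambda>x. f x * g x)"
    and expectation_X: "(\<integral>\<omega>. g (X 1 \<omega>) \<partial>M) = (\<integral>x. f x * g x \<partial>lborel)"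
  using distributed_integrable[OF X_density[of 1], of g] distributed_integral[OF X_density[of 1], of g] f_nonneg
  by (auto simp: mult.commute)

text \<open>\<open>b * f\<close> is integrable because \<open>b (X 1)\<close> is, and
  \<open>(b * f)^2 \<le> fb * f * b^2\<close> reduces its square to the second moment of
  \<open>b (X 1)\<close>.\<close>

lemma bf_L2: "(\<lambda>x. b x * f x) \<in> L2 lborel"
  and bf_integrable: "integrable lborel (\<lambda>x. b x * f x)"
proof -
  note [measurable] = b_measurable f_measurable
  show "integrable lborel (\<lambda>x. b x * f x)"
    using L2_integrable[OF L2_M(3)] integrable_X_iff[OF b_measurable] by (simp add: mult.commute)
  have int: "integrable lborel (\<lambda>x. fb * (f x * (b x)\<^sup>2))"
    using L2_square_integrable[OF L2_M(3)] integrable_X_iff[of "\<lambda>x. (b x)\<^sup>2"] by simp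
  show "(\<lambda>x. b x * f x) \<in> L2 lborel"
  proof (rule L2_I)
    show "integrable lborel (\<lambda>x. (b x * f x)\<^sup>2)"
    proof (rule Bochner_Integration.integrable_bound[OF int])
      have "(b x * f x)\<^sup>2 \<le> fb * (f x * (b x)\<^sup>2)" for x
        using mult_right_mono[OF f_le mult_nonneg_nonneg[OF f_nonneg zero_le_power2], of x x "b x"]
        by (simp add: power2_eq_square mult_ac)
      then show "AE x in lborel. norm ((b x * f x)\<^sup>2) \<le> norm (fb * (f x * (b x)\<^sup>2))"
        by (intro AE_I2) (auto intro: order_trans[OF _ abs_ge_self])
    qed simp
  qed simp
qed

lemma expectation_X_eps:
  assumes [measurable]: "g \<in> borel_measurable borel" and int: "integrable M (\<lambda>\<omega>. g (X 1 \<omega>))"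
  shows "integrable M (\<lambda>\<omega>. g (X 1 \<omega>) * \<epsilon> 1 \<omega>)" "(\<integral>\<omega>. g (X 1 \<omega>) * \<epsilon> 1 \<omega> \<partial>M) = 0"
proof -
  have "indep_var borel (g \<circ> X 1) borel (id \<circ> \<epsilon> 1)"
    by (rule indep_var_compose[OF indep_X_\<epsilon>]) simp_all
  then have i: "indep_var borel (\<lambda>\<omega>. g (X 1 \<omega>)) borel (\<epsilon> 1)" by (simp add: comp_def)
  show "integrable M (\<lambda>\<omega>. g (X 1 \<omega>) * \<epsilon> 1 \<omega>)"
    by (rule indep_var_integrable[OF i int eps_integrable(1)])
  show "(\<integral>\<omega>. g (X 1 \<omega>) * \<epsilon> 1 \<omega> \<partial>M) = 0"
    using indep_var_lebesgue_integral[OF i int eps_integrable(1)] eps_centered by simp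
qed

text \<open>The noise is centered and independent of the design, so the cross term vanishes and
  \<open>s2\<close> is at least the noise variance.\<close>

lemma s2_pos: "0 < s2"
proof -
  have "s2 = nsq M (\<lambda>\<omega>. b (X 1 \<omega>) + \<epsilon> 1 \<omega>)" by (simp add: s2_def nsq_def response_def)
  also have "\<dots> = nsq M (\<lambda>\<omega>. b (X 1 \<omega>)) + nsq M (\<epsilon> 1)"
    using nsq_add[OF L2_M(3,2)] expectation_X_eps(2)[OF b_measurable L2_integrable[OF L2_M(3)]] by simp
  also have "nsq M (\<epsilon> 1) = \<sigma>\<^sup>2" using eps_variance unfolding eps_centered by (simp add: nsq_def)
  finally show ?thesis using sigma_pos nsq_nonneg[of M "\<lambda>\<omega>. b (X 1 \<omega>)"] by linarith
qed

lemma s4_nonneg: "0 \<le> s4"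
  by (simp add: s4_def)

lemma
  fixes g :: "real \<times> real \<Rightarrow> real"
  assumes [measurable]: "g \<in> borel_measurable (borel \<Otimes>\<^sub>M borel)"
  shows integrable_P_iff: "integrable P g \<longleftrightarrow> integrable M (\<lambda>\<omega>. g (X 1 \<omega>, Y 1 \<omega>))"
    and integral_P: "(\<integral>z. g z \<partial>P) = (\<integral>\<omega>. g (X 1 \<omega>, Y 1 \<omega>) \<partial>M)"
  unfolding P_def
  by (rule integrable_distr_eq[OF XY_measurable[OF order_refl] assms],
      rule integral_distr[OF XY_measurable[OF order_refl] assms])

text \<open>Without the factor \<open>1 / n\<close>. It is used with \<open>trunc m\<close>, with
  \<open>tail m\<close> and with the identity for \<open>\<tau>\<close>.\<close>

definition summand :: "(real \<Rightarrow> real) \<Rightarrow> real \<Rightarrow> real \<times> real \<Rightarrow> real \<Rightarrow> real" where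
  "summand \<tau> h z x = scaled K h (fst z - x) * \<tau> (snd z)"

lemma measurable_summand [measurable]:
  assumes [measurable]: "\<tau> \<in> borel_measurable borel"
  shows "case_prod (summand \<tau> h) \<in> borel_measurable (P \<Otimes>\<^sub>M lborel)"
  unfolding summand_def split_beta' by measurable

lemma summand_L2: "0 < h \<Longrightarrow> summand \<tau> h z \<in> L2 lborel"
  unfolding summand_def[abs_def] by (intro L2_mult_const L2_reflect scaled_L2)

lemma nsq_summand:
  assumes "0 < h"
  shows "nsq lborel (summand \<tau> h z) = \<kappa> / h * (\<tau> (snd z))\<^sup>2"
proof -
  have "nsq lborel (summand \<tau> h z) = nsq lborel (\<lambda>x. \<tau> (snd z) * scaled K h (fst z - x))"
    by (simp add: summand_def[abs_def] mult.commute)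
  then show ?thesis
    by (simp add: nsq_cmult nsq_reflect nsq_scaled[OF assms] mult.commute)
qed

lemma L2_vector_summand:
  assumes [measurable]: "\<tau> \<in> borel_measurable borel" and \<tau>: "\<And>y. \<bar>\<tau> y\<bar> \<le> \<bar>y\<bar>"
    and D: "(\<integral>\<omega>. (\<tau> (Y 1 \<omega>))\<^sup>2 \<partial>M) \<le> D" and h: "0 < h"
  shows "L2_vector P lborel (summand \<tau> h) (\<kappa> / h * D)"
proof
  note [measurable] = Y_measurable[of 1, simplified]
  have \<tau>2: "(\<tau> y)\<^sup>2 \<le> y\<^sup>2" for y using \<tau>[of y] by (simp add: abs_le_square_iff)
  have \<tau>_int: "integrable M (\<lambda>\<omega>. (\<tau> (Y 1 \<omega>))\<^sup>2)"
    by (rule Bochner_Integration.integrable_bound[OF Y_moments(1)]) (use \<tau>2 in auto)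
  have D0: "0 \<le> D" using D by (rule order_trans[rotated]) simp
  show "case_prod (summand \<tau> h) \<in> borel_measurable (P \<Otimes>\<^sub>M lborel)" by measurable
  show "summand \<tau> h w \<in> L2 lborel" for w by (rule summand_L2[OF h])
  show "(\<lambda>w. summand \<tau> h w x) \<in> L2 P" for x
  proof (rule L2_I)
    show "(\<lambda>w. summand \<tau> h w x) \<in> borel_measurable P" unfolding summand_def by measurable
    obtain B where B: "\<And>x. \<bar>scaled K h x\<bar> \<le> B" using scaled_bounded by meson
    have "(\<lambda>w. (summand \<tau> h w x)\<^sup>2) \<in> borel_measurable (borel \<Otimes>\<^sub>M borel)" unfolding summand_def by measurable
    note eq = integrable_P_iff[OF this]
    show "integrable P (\<lambda>w. (summand \<tau> h w x)\<^sup>2)"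
      unfolding eq
    proof (rule Bochner_Integration.integrable_bound)
      show "integrable M (\<lambda>\<omega>. B\<^sup>2 * (\<tau> (Y 1 \<omega>))\<^sup>2)" using \<tau>_int by simp
      show "(\<lambda>\<omega>. (summand \<tau> h (X 1 \<omega>, Y 1 \<omega>) x)\<^sup>2) \<in> borel_measurable M"
        unfolding summand_def using X_measurable[of 1] by simp
      show "AE \<omega> in M. norm ((summand \<tau> h (X 1 \<omega>, Y 1 \<omega>) x)\<^sup>2) \<le> norm (B\<^sup>2 * (\<tau> (Y 1 \<omega>))\<^sup>2)"
        using power_mono[OF B abs_ge_zero, of _ 2]
        by (auto simp: summand_def power_mult_distrib intro!: mult_right_mono)
    qed
  qed
  have "(\<integral>\<^sup>+w. ennreal (nsq lborel (summand \<tau> h w)) \<partial>P) = (\<integral>\<^sup>+\<omega>. ennreal (\<kappa> / h * (\<tau> (Y 1 \<omega>))\<^sup>2) \<partial>M)"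
    using XY_measurable[of 1] unfolding P_def by (subst nn_integral_distr) (auto simp: nsq_summand[OF h])
  also have "\<dots> = ennreal (\<integral>\<omega>. \<kappa> / h * (\<tau> (Y 1 \<omega>))\<^sup>2 \<partial>M)"
    using \<tau>_int \<kappa>_pos h by (intro nn_integral_eq_integral) auto
  also have "\<dots> \<le> ennreal (\<kappa> / h * D)"
    using D \<kappa>_pos h by (intro ennreal_leI) (auto intro!: mult_left_mono divide_right_mono)
  finally show "(\<integral>\<^sup>+w. ennreal (nsq lborel (summand \<tau> h w)) \<partial>P) \<le> ennreal (\<kappa> / h * D)" .
  show "0 \<le> \<kappa> / h * D" using \<kappa>_pos h D0 by simp
qed

lemma inner_summand: "(\<integral>x. u x * summand \<tau> h z x \<partial>lborel) = fconv (scaled K h) u (fst z) * \<tau> (snd z)"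
  unfolding summand_def fconv_def integral_mult_left_zero[symmetric]
  by (rule Bochner_Integration.integral_cong) (simp_all add: mult_ac)

lemma expectation_square_le:
  assumes "g \<in> L2 lborel"
  shows "integrable M (\<lambda>\<omega>. (g (X 1 \<omega>))\<^sup>2)" "(\<integral>\<omega>. (g (X 1 \<omega>))\<^sup>2 \<partial>M) \<le> fb * nsq lborel g"
proof -
  have [measurable]: "g \<in> borel_measurable borel" using L2_measurable[OF assms] by simp
  note [measurable] = f_measurable
  have int: "integrable lborel (\<lambda>x. fb * (g x)\<^sup>2)" using L2_square_integrable[OF assms] by simp
  have le: "f x * (g x)\<^sup>2 \<le> fb * (g x)\<^sup>2" for x by (intro mult_right_mono f_le) simp
  have int2: "integrable lborel (\<lambda>x. f x * (g x)\<^sup>2)"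
    by (rule Bochner_Integration.integrable_bound[OF int])
      (use le f_nonneg fb_pos in \<open>auto intro!: AE_I2 simp: abs_mult\<close>)
  then show "integrable M (\<lambda>\<omega>. (g (X 1 \<omega>))\<^sup>2)" by (subst integrable_X_iff) auto
  have "(\<integral>\<omega>. (g (X 1 \<omega>))\<^sup>2 \<partial>M) = (\<integral>x. f x * (g x)\<^sup>2 \<partial>lborel)" by (rule expectation_X) simp
  also have "\<dots> \<le> (\<integral>x. fb * (g x)\<^sup>2 \<partial>lborel)" by (rule integral_mono[OF int2 int le])
  finally show "(\<integral>\<omega>. (g (X 1 \<omega>))\<^sup>2 \<partial>M) \<le> fb * nsq lborel g" by (simp add: nsq_def)
qed

text \<open>The two halves of the arithmetic-geometric mean inequality in
  \<open>weak_variance_summand\<close>: the fourth moment of the response, and the second moment of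
  a smoothed function at \<open>X 1\<close>.\<close>

definition v0 :: real where "v0 = (s4 + \<kappa> * fb * k1\<^sup>2) / 2"

lemma v0_pos: "0 < v0"
  using \<kappa>_pos fb_pos k1_ge_1 s4_nonneg by (simp add: v0_def add_nonneg_pos)

text \<open>The inner product is \<open>g (X 1) * \<tau> (Y 1)\<close> with \<open>g\<close> the
  smoothed \<open>u\<close>. In its square one factor \<open>\<bar>g\<bar>\<close> is bounded in sup
  norm, at the price \<open>1 / sqrt h\<close>; the rest is controlled by the \<open>L2\<close> norm
  of \<open>g\<close> and the fourth moment of the response. A bound of order \<open>1 / h\<close>
  would leave no decay in \<open>h\<close> in the Gaussian regime.\<close>

lemma weak_variance_summand:
  assumes \<tau>_meas [measurable]: "\<tau> \<in> borel_measurable borel" and \<tau>: "\<And>y. \<bar>\<tau> y\<bar> \<le> \<bar>y\<bar>"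
    and h: "0 < h" and u: "u \<in> L2 lborel"
  shows "(\<integral>z. (\<integral>x. u x * summand \<tau> h z x \<partial>lborel)\<^sup>2 \<partial>P) \<le> v0 / sqrt h * nsq lborel u"
proof -
  note [measurable] = Y_measurable[of 1, simplified] X_measurable[of 1, simplified]
  define g where "g = fconv (scaled K h) u"
  define s where "s = nsq lborel u"
  have s: "0 \<le> s" by (simp add: s_def nsq_nonneg)
  have gL2: "g \<in> L2 lborel" unfolding g_def by (rule fconv_scaled_L2[OF h u])
  have [measurable]: "g \<in> borel_measurable borel" using L2_measurable[OF gL2] by simp
  have pt: "(g t * \<tau> y)\<^sup>2 \<le> 1 / (2 * sqrt h) * (s * y ^ 4 + \<kappa> * (g t)\<^sup>2)" for t y
  proof -
    have "(g t)\<^sup>2 \<le> \<kappa> / h * s"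
      unfolding g_def s_def by (rule fconv_scaled_square_le[OF h u])
    then have "h * (g t)\<^sup>2 \<le> \<kappa> * s" using h by (simp add: field_simps)
    then have "sqrt (h * (g t)\<^sup>2) \<le> sqrt (\<kappa> * s)" by (rule real_sqrt_le_mono)
    then have "sqrt h * \<bar>g t\<bar> \<le> sqrt \<kappa> * sqrt s" by (simp add: real_sqrt_mult)
    \<comment> \<open>The multiplier is chosen so that the right side becomes
      \<open>2 * x * y\<close> with \<open>x^2 = s * y^4\<close> for the response and
      \<open>y^2 = \<kappa> * g^2\<close> for the design.\<close>
    then have "(sqrt h * \<bar>g t\<bar>) * (2 * y\<^sup>2 * \<bar>g t\<bar>) \<le> (sqrt \<kappa> * sqrt s) * (2 * y\<^sup>2 * \<bar>g t\<bar>)"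
      by (rule mult_right_mono) simp
    also have "\<dots> = 2 * (sqrt s * y\<^sup>2) * (sqrt \<kappa> * \<bar>g t\<bar>)" by simp
    also have "\<dots> \<le> (sqrt s * y\<^sup>2)\<^sup>2 + (sqrt \<kappa> * \<bar>g t\<bar>)\<^sup>2" by (rule sum_squares_bound)
    also have "\<dots> = s * y ^ 4 + \<kappa> * (g t)\<^sup>2"
      using s \<kappa>_pos by (simp add: power_mult_distrib flip: power_mult)
    finally have *: "2 * sqrt h * ((g t)\<^sup>2 * y\<^sup>2) \<le> s * y ^ 4 + \<kappa> * (g t)\<^sup>2"
      by (simp add: power2_eq_square mult_ac flip: abs_mult)
    have "(g t * \<tau> y)\<^sup>2 \<le> (g t)\<^sup>2 * y\<^sup>2"
      using \<tau>[of y] by (auto simp: power_mult_distrib abs_le_square_iff intro!: mult_left_mono)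
    also have "\<dots> \<le> 1 / (2 * sqrt h) * (s * y ^ 4 + \<kappa> * (g t)\<^sup>2)"
      using * h by (simp add: field_simps)
    finally show ?thesis .
  qed
  have int: "integrable M (\<lambda>\<omega>. 1 / (2 * sqrt h) * (s * (Y 1 \<omega>) ^ 4 + \<kappa> * (g (X 1 \<omega>))\<^sup>2))"
    using Y_moments(2) expectation_square_le(1)[OF gL2] by simp
  have "(\<integral>z. (\<integral>x. u x * summand \<tau> h z x \<partial>lborel)\<^sup>2 \<partial>P) = (\<integral>\<omega>. (g (X 1 \<omega>) * \<tau> (Y 1 \<omega>))\<^sup>2 \<partial>M)"
    unfolding inner_summand g_def[symmetric] by (subst integral_P) auto
  also have "\<dots> \<le> (\<integral>\<omega>. 1 / (2 * sqrt h) * (s * (Y 1 \<omega>) ^ 4 + \<kappa> * (g (X 1 \<omega>))\<^sup>2) \<partial>M)"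
    unfolding nsq_def[symmetric] by (rule nsq_mono[OF _ int pt]) simp
  also have "\<dots> = 1 / (2 * sqrt h) * (s * s4 + \<kappa> * (\<integral>\<omega>. (g (X 1 \<omega>))\<^sup>2 \<partial>M))"
    using Y_moments(2) expectation_square_le(1)[OF gL2] by (simp add: s4_def)
  also have "\<dots> \<le> 1 / (2 * sqrt h) * (s * s4 + \<kappa> * (fb * (k1\<^sup>2 * s)))"
  proof -
    have "nsq lborel g \<le> k1\<^sup>2 * s" unfolding g_def s_def by (rule Young_scaled[OF h u])
    then have "(\<integral>\<omega>. (g (X 1 \<omega>))\<^sup>2 \<partial>M) \<le> fb * (k1\<^sup>2 * s)"
      using expectation_square_le(2)[OF gL2] fb_pos
      by (meson mult_left_mono order_trans less_imp_le)
    then show ?thesis using h \<kappa>_pos by (intro mult_left_mono add_left_mono) auto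
  qed
  also have "\<dots> = v0 / sqrt h * s" using h by (simp add: v0_def field_simps)
  finally show ?thesis by (simp add: s_def)
qed

text \<open>The noise drops out by independence and centering, and evenness of \<open>K\<close>
  turns the remaining integral into a convolution.\<close>

lemma mean_summand:
  assumes h: "0 < h"
  shows "(\<integral>z. summand (\<lambda>y. y) h z x \<partial>P) = fconv (scaled K h) (\<lambda>x. b x * f x) x"
proof -
  note [measurable] = b_measurable
  obtain B where B: "\<And>x. \<bar>scaled K h x\<bar> \<le> B" using scaled_bounded by meson
  have XM: "X 1 \<in> borel_measurable M" by (simp add: X_measurable)
  have intK: "integrable M (\<lambda>\<omega>. scaled K h (X 1 \<omega> - x))"
    using XM B by (intro integrable_const_bound[of _ B]) auto
  have intb: "integrable M (\<lambda>\<omega>. scaled K h (X 1 \<omega> - x) * b (X 1 \<omega>))"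
  proof (rule Bochner_Integration.integrable_bound)
    show "integrable M (\<lambda>\<omega>. B * b (X 1 \<omega>))" using L2_integrable[OF L2_M(3)] by simp
    show "AE \<omega> in M. norm (scaled K h (X 1 \<omega> - x) * b (X 1 \<omega>)) \<le> norm (B * b (X 1 \<omega>))"
      using order_trans[OF B abs_ge_self] by (auto simp: abs_mult intro!: mult_right_mono)
  qed (use XM in simp)
  have "(\<integral>z. summand (\<lambda>y. y) h z x \<partial>P) = (\<integral>\<omega>. scaled K h (X 1 \<omega> - x) * Y 1 \<omega> \<partial>M)"
    unfolding summand_def by (subst integral_P) auto
  also have "\<dots> = (\<integral>\<omega>. scaled K h (X 1 \<omega> - x) * b (X 1 \<omega>) + scaled K h (X 1 \<omega> - x) * \<epsilon> 1 \<omega> \<partial>M)"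
    by (simp add: response_def distrib_left)
  also have "\<dots> = (\<integral>\<omega>. scaled K h (X 1 \<omega> - x) * b (X 1 \<omega>) \<partial>M)"
    using expectation_X_eps[of "\<lambda>t. scaled K h (t - x)", OF _ intK] intb by simp
  also have "\<dots> = (\<integral>t. f t * (scaled K h (t - x) * b t) \<partial>lborel)"
    by (rule expectation_X) simp
  also have "\<dots> = fconv (scaled K h) (\<lambda>x. b x * f x) x"
    unfolding fconv_def by (rule Bochner_Integration.integral_cong) (simp_all add: scaled_minus_commute[of h x])
  finally show ?thesis .
qed

end

section \<open>The excess of the estimators over the threshold\<close>

lemma ennreal_le_combination:
  assumes "x \<le> a * y + a * z" "0 \<le> a" "0 \<le> y" "0 \<le> z"
  shows "ennreal x \<le> ennreal a * ennreal y + ennreal a * ennreal z"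
proof -
  have "ennreal a * ennreal y + ennreal a * ennreal z = ennreal (a * y + a * z)"
    using assms(2-4) by (simp add: ennreal_mult)
  then show ?thesis using assms(1) by (simp add: ennreal_leI)
qed

context kernel_regression
begin

lemma nn_integral_sample:
  assumes I: "I \<noteq> {}" "I \<subseteq> {1..}" and g: "g \<in> borel_measurable (PiM I (\<lambda>_. P))"
  shows "(\<integral>\<^sup>+\<omega>. g (\<lambda>i\<in>I. (X i \<omega>, Y i \<omega>)) \<partial>M) = (\<integral>\<^sup>+z. g z \<partial>PiM I (\<lambda>_. P))"
proof -
  have "(\<lambda>\<omega>. \<lambda>i\<in>I. (X i \<omega>, Y i \<omega>)) \<in> M \<rightarrow>\<^sub>M PiM I (\<lambda>_. borel \<Otimes>\<^sub>M borel)"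
    using I(2) XY_measurable by (intro measurable_restrict) auto
  moreover have "sets (PiM I (\<lambda>_. P)) = sets (PiM I (\<lambda>_. borel \<Otimes>\<^sub>M borel))"
    by (intro sets_PiM_cong) simp_all
  then have "g \<in> borel_measurable (PiM I (\<lambda>_. borel \<Otimes>\<^sub>M borel))"
    using g by (simp cong: measurable_cong_sets)
  ultimately show ?thesis
    unfolding distr_sample[OF I, symmetric] by (subst nn_integral_distr) simp_all
qed

text \<open>\<open>trunc m\<close> and \<open>tail m\<close> add up to the identity and are
  dominated by the absolute value, so the moment bounds of the full response apply to both at every
  level \<open>m\<close>.\<close>

definition trunc :: "real \<Rightarrow> real \<Rightarrow> real" where
  "trunc m y = (if \<bar>y\<bar> \<le> m then y else 0)"

definition tail :: "real \<Rightarrow> real \<Rightarrow> real" where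
  "tail m y = (if \<bar>y\<bar> \<le> m then 0 else y)"

lemma measurable_trunc [measurable]: "trunc m \<in> borel_measurable borel"
  unfolding trunc_def[abs_def] by measurable

lemma measurable_tail [measurable]: "tail m \<in> borel_measurable borel"
  unfolding tail_def[abs_def] by measurable

lemma trunc_second_moment: "(\<integral>\<omega>. (trunc m (Y 1 \<omega>))\<^sup>2 \<partial>M) \<le> s2"
  unfolding s2_def nsq_def[symmetric] using Y_measurable[of 1] Y_moments(1)
  unfolding nsq_def[of M "Y 1"] by (intro nsq_mono) (auto simp: trunc_def)

text \<open>Where \<open>\<bar>y\<bar>\<close> exceeds \<open>m\<close>, one factor
  \<open>y^2\<close> is at least \<open>m^2\<close>.\<close>

lemma tail_second_moment:
  assumes m: "0 < m"
  shows "(\<integral>\<omega>. (tail m (Y 1 \<omega>))\<^sup>2 \<partial>M) \<le> s4 / m\<^sup>2"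
proof -
  have "(tail m y)\<^sup>2 \<le> y ^ 4 / m\<^sup>2" for y
  proof (cases "\<bar>y\<bar> \<le> m")
    case False
    then have "m\<^sup>2 * y\<^sup>2 \<le> y\<^sup>2 * y\<^sup>2"
      using m by (intro mult_right_mono) (auto simp: abs_le_square_iff[symmetric])
    then show ?thesis using False m by (simp add: tail_def field_simps flip: power_add)
  qed (simp add: tail_def)
  then have "nsq M (\<lambda>\<omega>. tail m (Y 1 \<omega>)) \<le> (\<integral>\<omega>. (Y 1 \<omega>) ^ 4 / m\<^sup>2 \<partial>M)"
    using Y_measurable[of 1] Y_moments(2) by (intro nsq_mono) auto
  then show ?thesis by (simp add: nsq_def s4_def)
qed

lemma bf_hat_eq_est: "bf_hat K X Y n h \<omega> = est {1..n} (\<lambda>i. X i \<omega>) (\<lambda>i. Y i \<omega> / real n) h"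
  by (auto simp: bf_hat_def est_def scaled_def sum_distrib_left fun_eq_iff intro!: sum.cong)

text \<open>In this order: the Gaussian regime and the Bernstein regime of the truncated part, and
  the second moment of the remainder. With the factor \<open>2 / n^2\<close> of the splitting,
  \<open>6912 = 2 * 54 * 64\<close>, \<open>27 / 4 = 2 * 54 * 16 / 256\<close> and
  \<open>512 = 2 * 256\<close>, where 256 is the square of the 16 in the truncation level.\<close>

definition excess_bound :: "nat \<Rightarrow> real \<Rightarrow> real" where
  "excess_bound n h = 6912 * v0\<^sup>2 / (\<kappa> * s2 * real n) * exp (- (\<kappa> * s2 / (32 * v0)) / sqrt h)
    + 27 / 4 * (\<kappa> * s2) / ((real n)\<^sup>2 * h * (ln (real n))\<^sup>2)
    + 512 * \<kappa> * s4 * (ln (real n))\<^sup>2 / (s2 * (real n)\<^sup>2 * h)"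

text \<open>The level \<open>m = \<surd>(s2 n) / (16 ln n)\<close> balances the two parts: the truncated responses
  contribute the factor \<open>exp (- R / (8 B)) = 1 / n\<close>, and the variance of the remainder is of
  order \<open>1 / m\<^sup>2\<close>, which causes the term \<open>(ln n)\<^sup>2 / n\<close>.\<close>

lemma nn_integral_excess_le:
  assumes n: "2 \<le> n" and h: "0 < h"
  shows "(\<integral>\<^sup>+\<omega>. ennreal (max 0 (nsq lborel (\<lambda>x. bf_hat K X Y n h \<omega> x
      - fconv (scaled K h) (\<lambda>x. b x * f x) x) - 18 * (\<kappa> * s2 / (real n * h)))) \<partial>M)
    \<le> ennreal (excess_bound n h)"
proof -
  define L where "L = ln (real n)"
  have "2 / 3 \<le> ln (2 :: real)" by (rule ln2_ge_two_thirds)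
  also have "\<dots> \<le> L" using n by (simp add: L_def)
  finally have L: "2 / 3 \<le> L" .
  define m where "m = sqrt (s2 * real n) / (16 * L)"
  have m: "0 < m" using s2_pos n L by (simp add: m_def)
  have m2: "m\<^sup>2 = s2 * real n / (256 * L\<^sup>2)"
    using s2_pos by (simp add: m_def power_divide power_mult_distrib)
  interpret C: L2_vector P lborel "summand (trunc m) h" "\<kappa> / h * s2"
    by (rule L2_vector_summand[OF measurable_trunc _ trunc_second_moment h]) (simp add: trunc_def)
  interpret T: L2_vector P lborel "summand (tail m) h" "\<kappa> / h * (s4 / m\<^sup>2)"
    by (rule L2_vector_summand[OF measurable_tail _ tail_second_moment[OF m] h]) (simp add: tail_def)
  define \<mu> where "\<mu> = fconv (scaled K h) (\<lambda>x. b x * f x)"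
  have mean: "C.mean x + T.mean x = \<mu> x" for x
  proof -
    have "C.mean x + T.mean x = (\<integral>z. summand (trunc m) h z x + summand (tail m) h z x \<partial>P)"
      using P.L2_integrable[OF C.\<phi>_pointwise_L2[of x]] P.L2_integrable[OF T.\<phi>_pointwise_L2[of x]]
      by (simp add: C.mean_def T.mean_def)
    also have "\<dots> = (\<integral>z. summand (\<lambda>y. y) h z x \<partial>P)"
      by (rule Bochner_Integration.integral_cong) (simp_all add: summand_def trunc_def tail_def)
    finally show ?thesis using mean_summand[OF h, of x] by (simp add: \<mu>_def)
  qed
  have dev: "C.dev z x + T.dev z x = summand (\<lambda>y. y) h z x - \<mu> x" for z x
    unfolding C.dev_def T.dev_def mean[symmetric] by (simp add: summand_def trunc_def tail_def)
  define I where "I = {1..n}"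
  have I: "I \<noteq> {}" "I \<subseteq> {1..}" "finite I" "card I = n" using n by (auto simp: I_def)
  define R where "R = sqrt (real n * (\<kappa> / h * s2))"
  have R: "0 < R" using n h \<kappa>_pos s2_pos by (simp add: R_def)
  have R2: "R\<^sup>2 = real n * (\<kappa> / h * s2)" using h \<kappa>_pos s2_pos by (simp add: R_def)
  \<comment> \<open>Norm of a truncated summand, doubled on account of centering.\<close>
  define B where "B = 2 * m * sqrt (\<kappa> / h)"
  have B: "0 < B" using m h \<kappa>_pos by (simp add: B_def)
  have B2: "B\<^sup>2 = 4 * (\<kappa> / h * m\<^sup>2)" using h \<kappa>_pos by (simp add: B_def power_mult_distrib)
  have RB: "R / (8 * B) = L"
  proof -
    have "R = sqrt (s2 * real n) * sqrt (\<kappa> / h)" by (simp add: R_def mult_ac flip: real_sqrt_mult)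
    also have "sqrt (s2 * real n) = 16 * L * m" using L by (simp add: m_def)
    finally show ?thesis using B m h \<kappa>_pos by (simp add: B_def)
  qed
  \<comment> \<open>\<open>R = 8 * B * L\<close>, and \<open>L\<close> is at least
    \<open>2 / 3\<close> because \<open>n\<close> is at least 2.\<close>
  have BR: "B \<le> 2 * R"
  proof -
    have "R = 8 * B * L" using RB B by (simp add: field_simps)
    moreover have "B * 1 \<le> B * (16 * L)" using B L by (intro mult_left_mono) auto
    ultimately show ?thesis by simp
  qed
  have C_bound: "nsq lborel (C.dev w) \<le> B\<^sup>2" for w
    unfolding B2
  proof (rule C.nsq_dev_le)
    fix w :: "real \<times> real"
    have "(trunc m (snd w))\<^sup>2 \<le> m\<^sup>2" using m by (auto simp: trunc_def abs_le_square_iff[symmetric])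
    then show "nsq lborel (summand (trunc m) h w) \<le> \<kappa> / h * m\<^sup>2"
      unfolding nsq_summand[OF h] using \<kappa>_pos h by (intro mult_left_mono) auto
  qed simp
  have C_weak: "(\<integral>w. (\<integral>x. u x * C.dev w x \<partial>lborel)\<^sup>2 \<partial>P) \<le> v0 / sqrt h * nsq lborel u"
    if u: "u \<in> L2 lborel" for u
    by (rule C.weak_variance_dev_le[OF u weak_variance_summand[OF measurable_trunc _ h u]]) (simp add: trunc_def)
  have v: "0 < v0 / sqrt h" using v0_pos h by simp
  have card_R: "R\<^sup>2 = real (card I) * (\<kappa> / h * s2)" by (simp add: R2 I)
  define A where "A = 54 * ((8 * real n * (v0 / sqrt h) / R)\<^sup>2 * exp (- (R\<^sup>2 / (32 * real n * (v0 / sqrt h))))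
        + (2 * B)\<^sup>2 * exp (- (R / (8 * B))))"
  have C_excess: "(\<integral>\<^sup>+z. ennreal (max 0 (nsq lborel (C.dev.S I z) - 9 * R\<^sup>2)) \<partial>PiM I (\<lambda>_. P)) \<le> ennreal A"
    using C.dev.nn_integral_excess_le[OF C_bound C_weak v R B BR I(3) card_R] by (simp add: A_def I)
  have T_var: "(\<integral>\<^sup>+z. ennreal (nsq lborel (T.dev.S I z)) \<partial>PiM I (\<lambda>_. P))
      \<le> ennreal (real n * (\<kappa> / h * (s4 / m\<^sup>2)))"
    using T.dev.nn_integral_nsq_S_le[OF I(3)] by (simp add: I)
  define Z where "Z = (\<lambda>\<omega>. \<lambda>i\<in>I. (X i \<omega>, Y i \<omega>))"
  \<comment> \<open>Squaring the sum of the truncated part and the remainder costs a factor 2, which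
    raises \<open>9 * R^2\<close> to the threshold 18. The remainder gets no threshold; its whole
    second moment is counted.\<close>
  have pt: "max 0 (nsq lborel (\<lambda>x. bf_hat K X Y n h \<omega> x - \<mu> x) - 18 * (\<kappa> * s2 / (real n * h)))
      \<le> 2 / (real n)\<^sup>2 * max 0 (nsq lborel (C.dev.S I (Z \<omega>)) - 9 * R\<^sup>2)
        + 2 / (real n)\<^sup>2 * nsq lborel (T.dev.S I (Z \<omega>))" for \<omega>
  proof -
    have Z: "Z \<omega> \<in> space (PiM I (\<lambda>_. P))" by (simp add: Z_def space_PiM)
    have "bf_hat K X Y n h \<omega> x - \<mu> x = 1 / real n * (C.dev.S I (Z \<omega>) x + T.dev.S I (Z \<omega>) x)" for x
    proof -
      have "C.dev.S I (Z \<omega>) x + T.dev.S I (Z \<omega>) x = (\<Sum>i\<in>I. summand (\<lambda>y. y) h (Z \<omega> i) x - \<mu> x)"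
        by (simp add: C.dev.S_def T.dev.S_def dev flip: sum.distrib)
      also have "\<dots> = (\<Sum>i\<in>I. scaled K h (X i \<omega> - x) * Y i \<omega>) - real n * \<mu> x"
        by (simp add: sum_subtractf I summand_def Z_def)
      finally show ?thesis using n
        by (simp add: bf_hat_eq_est est_def I_def sum_divide_distrib[symmetric] diff_divide_distrib mult.commute)
    qed
    then have "nsq lborel (\<lambda>x. bf_hat K X Y n h \<omega> x - \<mu> x)
        = (1 / real n)\<^sup>2 * nsq lborel (\<lambda>x. C.dev.S I (Z \<omega>) x + T.dev.S I (Z \<omega>) x)"
      by (simp only: nsq_cmult)
    also have "\<dots> \<le> (1 / real n)\<^sup>2 * (2 * nsq lborel (C.dev.S I (Z \<omega>)) + 2 * nsq lborel (T.dev.S I (Z \<omega>)))"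
      by (intro mult_left_mono nsq_add_le C.dev.S_L2 T.dev.S_L2 Z) simp
    also have "\<dots> = 2 / (real n)\<^sup>2 * (nsq lborel (C.dev.S I (Z \<omega>)) - 9 * R\<^sup>2)
        + 2 / (real n)\<^sup>2 * nsq lborel (T.dev.S I (Z \<omega>)) + 2 / (real n)\<^sup>2 * (9 * R\<^sup>2)"
      by (simp add: power_divide add_divide_distrib diff_divide_distrib algebra_simps)
    also have "2 / (real n)\<^sup>2 * (9 * R\<^sup>2) = 18 * (\<kappa> * s2 / (real n * h))"
      unfolding R2 using n h by (simp add: power2_eq_square)
    finally have "nsq lborel (\<lambda>x. bf_hat K X Y n h \<omega> x - \<mu> x) - 18 * (\<kappa> * s2 / (real n * h))
        \<le> 2 / (real n)\<^sup>2 * (nsq lborel (C.dev.S I (Z \<omega>)) - 9 * R\<^sup>2)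
          + 2 / (real n)\<^sup>2 * nsq lborel (T.dev.S I (Z \<omega>))" by simp
    also have "\<dots> \<le> 2 / (real n)\<^sup>2 * max 0 (nsq lborel (C.dev.S I (Z \<omega>)) - 9 * R\<^sup>2)
          + 2 / (real n)\<^sup>2 * nsq lborel (T.dev.S I (Z \<omega>))"
      by (intro add_right_mono mult_left_mono) auto
    finally show ?thesis by (simp add: nsq_nonneg)
  qed
  define a where "a = 2 / (real n)\<^sup>2"
  have a: "0 \<le> a" by (simp add: a_def)
  have "(\<integral>\<^sup>+\<omega>. ennreal (max 0 (nsq lborel (\<lambda>x. bf_hat K X Y n h \<omega> x - \<mu> x)
        - 18 * (\<kappa> * s2 / (real n * h)))) \<partial>M)
      \<le> (\<integral>\<^sup>+\<omega>. (\<lambda>z. ennreal a * ennreal (max 0 (nsq lborel (C.dev.S I z) - 9 * R\<^sup>2))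
        + ennreal a * ennreal (nsq lborel (T.dev.S I z))) (Z \<omega>) \<partial>M)"
    using pt[folded a_def] a
    by (intro nn_integral_mono ennreal_le_combination) (simp_all only: nsq_nonneg max.cobounded1)
  also have "\<dots> = (\<integral>\<^sup>+z. ennreal a * ennreal (max 0 (nsq lborel (C.dev.S I z) - 9 * R\<^sup>2))
        + ennreal a * ennreal (nsq lborel (T.dev.S I z)) \<partial>PiM I (\<lambda>_. P))"
    unfolding Z_def by (rule nn_integral_sample[OF I(1,2)]) measurable
  also have "\<dots> = ennreal a * (\<integral>\<^sup>+z. ennreal (max 0 (nsq lborel (C.dev.S I z) - 9 * R\<^sup>2)) \<partial>PiM I (\<lambda>_. P))
        + ennreal a * (\<integral>\<^sup>+z. ennreal (nsq lborel (T.dev.S I z)) \<partial>PiM I (\<lambda>_. P))"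
    by (subst nn_integral_add) (auto simp: nn_integral_cmult)
  also have "\<dots> \<le> ennreal a * ennreal A + ennreal a * ennreal (real n * (\<kappa> / h * (s4 / m\<^sup>2)))"
    by (intro add_mono mult_left_mono C_excess T_var) auto
  also have "\<dots> = ennreal (a * A + a * (real n * (\<kappa> / h * (s4 / m\<^sup>2))))"
    using a h \<kappa>_pos s4_nonneg by (simp add: A_def flip: ennreal_mult ennreal_plus)
  also have "a * A + a * (real n * (\<kappa> / h * (s4 / m\<^sup>2))) = excess_bound n h"
  proof -
    have sq: "(8 * real n * (v0 / sqrt h) / R)\<^sup>2 = 64 * real n * v0\<^sup>2 / (\<kappa> * s2)"
      unfolding power_divide power_mult_distrib R2 using h n by (simp add: power2_eq_square field_simps)
    \<comment> \<open>\<open>R^2 / n\<close> is of order \<open>1 / h\<close> and the weak variance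
      of order \<open>1 / sqrt h\<close>, so \<open>1 / sqrt h\<close> remains in the
      exponent.\<close>
    have ex: "R\<^sup>2 / (32 * real n * (v0 / sqrt h)) = \<kappa> * s2 / (32 * v0) / sqrt h"
    proof -
      have "h = sqrt h * sqrt h" using h by simp
      then have "\<kappa> / h = \<kappa> / (sqrt h * sqrt h)" by simp
      then show ?thesis unfolding R2 using h n v0_pos by (simp add: field_simps)
    qed
    have ex2: "exp (- (R / (8 * B))) = 1 / real n"
      unfolding RB L_def using n by (simp add: exp_minus divide_inverse)
    have "a * A = 6912 * v0\<^sup>2 / (\<kappa> * s2 * real n) * exp (- (\<kappa> * s2 / (32 * v0)) / sqrt h)
        + 27 / 4 * (\<kappa> * s2) / ((real n)\<^sup>2 * h * L\<^sup>2)"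
      unfolding A_def sq ex ex2 a_def power_mult_distrib B2 m2 using n h L \<kappa>_pos s2_pos
      by (simp add: field_simps power2_eq_square)
    moreover have "a * (real n * (\<kappa> / h * (s4 / m\<^sup>2))) = 512 * \<kappa> * s4 * L\<^sup>2 / (s2 * (real n)\<^sup>2 * h)"
      unfolding a_def m2 using n h L s2_pos by (simp add: field_simps power2_eq_square)
    ultimately show ?thesis by (simp add: excess_bound_def L_def)
  qed
  finally show ?thesis by (simp add: \<mu>_def)
qed

text \<open>The exponential terms are summed by the second bandwidth condition, the terms with
  \<open>1 / h\<close> by the first, whose factor \<open>1 / n\<close> turns their
  \<open>1 / n^2\<close> into \<open>1 / n\<close>.\<close>

lemma sum_excess_bound_le:
  assumes n: "2 \<le> n" and H: "\<And>h. h \<in> H \<Longrightarrow> 0 < h" "\<And>h. h \<in> H \<Longrightarrow> h \<le> 1"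
    and mH: "1 / real n * (\<Sum>h\<in>H. 1 / h) \<le> mH"
    and m0: "(\<Sum>h\<in>H. 1 / sqrt h * exp (- (\<kappa> * s2 / (32 * v0)) / sqrt h)) \<le> m0"
  shows "(\<Sum>h\<in>H. excess_bound n h)
    \<le> (6912 * v0\<^sup>2 / (\<kappa> * s2) * m0 / (ln 2)\<^sup>2 + 27 / 4 * (\<kappa> * s2) * mH / (ln 2) ^ 4
        + 512 * \<kappa> * s4 / s2 * mH) * ((ln (real n))\<^sup>2 / real n)"
proof -
  define L where "L = ln (real n)"
  define l where "l = ln (2 :: real)"
  have l: "0 < l" by (simp add: l_def)
  have lL: "l \<le> L" using n by (simp add: l_def L_def)
  have L: "0 < L" using l lL by simp
  have sq: "l\<^sup>2 \<le> L\<^sup>2" using l lL by (intro power_mono) auto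
  \<comment> \<open>\<open>ln n\<close> is at least \<open>ln 2\<close>, so orders smaller than
    \<open>(ln n)^2 / n\<close> are absorbed at the cost of powers of
    \<open>1 / ln 2\<close>.\<close>
  have q: "1 / real n \<le> (L\<^sup>2 / real n) / l\<^sup>2" "1 / (real n * L\<^sup>2) \<le> (L\<^sup>2 / real n) / l ^ 4"
  proof -
    show "1 / real n \<le> (L\<^sup>2 / real n) / l\<^sup>2" using sq l n by (simp add: field_simps)
    have "l ^ 4 \<le> L\<^sup>2 * L\<^sup>2" using sq l lL by (simp add: power_mono flip: power_add)
    then show "1 / (real n * L\<^sup>2) \<le> (L\<^sup>2 / real n) / l ^ 4" using l L n by (simp add: field_simps)
  qed
  define S0 where "S0 = (\<Sum>h\<in>H. exp (- (\<kappa> * s2 / (32 * v0)) / sqrt h))"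
  define S1 where "S1 = 1 / real n * (\<Sum>h\<in>H. 1 / h)"
  have S0: "0 \<le> S0" by (simp add: S0_def sum_nonneg)
  have S1: "0 \<le> S1" using H by (simp add: S1_def sum_nonneg less_imp_le)
  have "S0 \<le> (\<Sum>h\<in>H. 1 / sqrt h * exp (- (\<kappa> * s2 / (32 * v0)) / sqrt h))"
    unfolding S0_def
  proof (rule sum_mono)
    fix h assume h: "h \<in> H"
    \<comment> \<open>Bandwidths are at most 1, so the plain exponential is dominated by the
      weighted one of the hypothesis.\<close>
    then have "1 \<le> 1 / sqrt h" using H[OF h] by simp
    then show "exp (- (\<kappa> * s2 / (32 * v0)) / sqrt h) \<le> 1 / sqrt h * exp (- (\<kappa> * s2 / (32 * v0)) / sqrt h)"
      using mult_right_mono[of 1 "1 / sqrt h" "exp (- (\<kappa> * s2 / (32 * v0)) / sqrt h)"] by simp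
  qed
  also note m0
  finally have S0m: "S0 \<le> m0" .
  have S1m: "S1 \<le> mH" using mH by (simp add: S1_def)
  have "(\<Sum>h\<in>H. excess_bound n h) = 6912 * v0\<^sup>2 / (\<kappa> * s2) * S0 * (1 / real n)
      + 27 / 4 * (\<kappa> * s2) * S1 * (1 / (real n * L\<^sup>2)) + 512 * \<kappa> * s4 / s2 * S1 * (L\<^sup>2 / real n)"
  proof -
    have "(\<Sum>h\<in>H. excess_bound n h) = (\<Sum>h\<in>H.
        6912 * v0\<^sup>2 / (\<kappa> * s2) * (1 / real n) * exp (- (\<kappa> * s2 / (32 * v0)) / sqrt h)
      + 27 / 4 * (\<kappa> * s2) * (1 / (real n * L\<^sup>2)) * (1 / real n) * (1 / h)
      + 512 * \<kappa> * s4 / s2 * (L\<^sup>2 / real n) * (1 / real n) * (1 / h))"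
      by (rule sum.cong) (simp_all add: excess_bound_def L_def power2_eq_square mult_ac)
    also have "\<dots> = 6912 * v0\<^sup>2 / (\<kappa> * s2) * (1 / real n) * S0
      + 27 / 4 * (\<kappa> * s2) * (1 / (real n * L\<^sup>2)) * (1 / real n) * (\<Sum>h\<in>H. 1 / h)
      + 512 * \<kappa> * s4 / s2 * (L\<^sup>2 / real n) * (1 / real n) * (\<Sum>h\<in>H. 1 / h)"
      unfolding sum.distrib sum_distrib_left[symmetric] S0_def ..
    finally show ?thesis by (simp only: S1_def mult_ac)
  qed
  also have "\<dots> \<le> 6912 * v0\<^sup>2 / (\<kappa> * s2) * m0 * ((L\<^sup>2 / real n) / l\<^sup>2)
      + 27 / 4 * (\<kappa> * s2) * mH * ((L\<^sup>2 / real n) / l ^ 4) + 512 * \<kappa> * s4 / s2 * mH * (L\<^sup>2 / real n)"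
    using S0 S1 S0m S1m \<kappa>_pos s2_pos s4_nonneg
    by (intro add_mono mult_mono q mult_nonneg_nonneg order_refl) auto
  also have "\<dots> = (6912 * v0\<^sup>2 / (\<kappa> * s2) * m0 / l\<^sup>2 + 27 / 4 * (\<kappa> * s2) * mH / l ^ 4
        + 512 * \<kappa> * s4 / s2 * mH) * (L\<^sup>2 / real n)"
    by (simp add: algebra_simps)
  finally show ?thesis by (simp add: l_def L_def)
qed

end

section \<open>The risk bound\<close>

context kernel_regression
begin

lemma measurable_nsq_bf_hat:
  assumes [measurable]: "g \<in> borel_measurable borel"
  shows "(\<lambda>\<omega>. nsq lborel (\<lambda>x. bf_hat K X Y n h \<omega> x - g x)) \<in> borel_measurable M"
proof -
  have [measurable]: "X i \<in> borel_measurable M" "Y i \<in> borel_measurable M" if "i \<in> {1..n}" for i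
    using that X_measurable[of i] Y_measurable[of i] by simp_all
  show ?thesis
    unfolding nsq_def bf_hat_def by measurable
qed

lemma c_KY_eq: "c_KY M K Y = \<kappa> * s2"
  by (simp add: c_KY_def Lp_norm_2_power2 \<kappa>_def s2_def)

lemma GL_V_eq: "GL_V M K Y \<upsilon> n h = \<upsilon> * (\<kappa> * s2 / (real n * h)) * k1\<^sup>2"
  by (simp add: GL_V_def c_KY_eq Lp_norm_1_K)

text \<open>The oracle inequality at each sample point yields a measurable majorant in which
  \<open>hhat\<close> no longer occurs. Only monotonicity of the integral is applied to the risk
  itself, so \<open>hhat\<close> may be non-measurable.\<close>

lemma GL_risk_le:
  assumes n: "2 \<le> n" and H: "bandwidths n H" and \<upsilon>: "144 \<le> \<upsilon>"
    and sel: "GL_selection M K X Y \<upsilon> n H hhat"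
  shows "(\<integral>\<^sup>+\<omega>. ennreal ((Lp_norm 2 (\<lambda>x. bf_hat K X Y n (hhat \<omega>) \<omega> x - b x * f x))\<^sup>2) \<partial>M)
    \<le> ennreal ((12 * k1\<^sup>2 + 12) * (INF h\<in>H. (Lp_norm 2 (\<lambda>x. fconv (scaled K h) (\<lambda>x. b x * f x) x - b x * f x))\<^sup>2
          + GL_V M K Y \<upsilon> n h)
        + (48 * k1\<^sup>2 + 6) * (\<Sum>h\<in>H. excess_bound n h))"
proof -
  note [measurable] = b_measurable f_measurable
  have fin: "finite H" and ne: "H \<noteq> {}" and lower: "\<And>h. h \<in> H \<Longrightarrow> 1 / real n < h"
    using H by (auto simp: bandwidths_def)
  have pos: "0 < h" if "h \<in> H" for h
    using lower[OF that] n by (intro less_trans[of 0 "1 / real n" h]) simp_all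
  have k: "0 < k1" using k1_ge_1 by simp
  define V where "V = GL_V M K Y \<upsilon> n"
  have V: "0 \<le> V h" if "h \<in> H" for h
    using \<upsilon> \<kappa>_pos s2_pos pos[OF that] by (simp add: V_def GL_V_eq)
  define g where "g = (\<lambda>x. b x * f x)"
  have g: "g \<in> L2 lborel" "integrable lborel g" using bf_L2 bf_integrable by (simp_all add: g_def)
  have [measurable]: "g \<in> borel_measurable borel" unfolding g_def by measurable
  define r where "r = (\<lambda>h. nsq lborel (\<lambda>x. fconv (scaled K h) g x - g x) + V h)"
  \<comment> \<open>\<open>H\<close> is finite, so the infimum is attained and the oracle inequality
    can be applied at a minimizer.\<close>
  have "Inf (r ` H) \<in> r ` H" using fin ne by (simp add: cInf_eq_Min)
  then obtain h where h: "h \<in> H" and r_h: "Inf (r ` H) = r h" by auto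
  define W where "W = (\<lambda>\<omega> \<eta>. max 0 (nsq lborel (\<lambda>x. bf_hat K X Y n \<eta> \<omega> x - fconv (scaled K \<eta>) g x)
      - 18 * (\<kappa> * s2 / (real n * \<eta>))))"
  have W_meas: "(\<lambda>\<omega>. W \<omega> \<eta>) \<in> borel_measurable M" for \<eta>
    unfolding W_def using measurable_nsq_bf_hat[of "fconv (scaled K \<eta>) g" n \<eta>] by simp
  have risk: "(Lp_norm 2 (\<lambda>x. bf_hat K X Y n (hhat \<omega>) \<omega> x - g x))\<^sup>2
      \<le> (12 * k1\<^sup>2 + 12) * r h + (48 * k1\<^sup>2 + 6) * (\<Sum>\<eta>\<in>H. W \<omega> \<eta>)" if \<omega>: "\<omega> \<in> space M" for \<omega>
  proof -
    interpret orc: kernel_oracle K H "{1..n}" "\<lambda>i. X i \<omega>" "\<lambda>i. Y i \<omega> / real n" g V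
      "GL_A M K X Y \<upsilon> n H \<omega>" "hhat \<omega>"
    proof
      show "is_arg_min (\<lambda>h. GL_A M K X Y \<upsilon> n H \<omega> h + V h) (\<lambda>h. h \<in> H) (hhat \<omega>)"
        using sel \<omega> by (simp add: GL_selection_def V_def)
    qed (use fin pos g V in \<open>auto simp: GL_A_def Lp_norm_2_power2 bf_hat2_def bf_hat_eq_est V_def\<close>)
    have "orc.excess \<le> (\<Sum>\<eta>\<in>H. W \<omega> \<eta>)"
      unfolding orc.excess_def
    proof (rule sum_mono)
      fix \<eta> assume \<eta>: "\<eta> \<in> H"
      \<comment> \<open>\<open>144 = 8 * 18\<close>: the threshold of \<open>excess\<close> divides
        \<open>V\<close> by \<open>8 * k1^2\<close>, the \<open>k1^2\<close> of the penalty cancels,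
        and the 18 of \<open>nn_integral_excess_le\<close> must remain.\<close>
      have "144 * (\<kappa> * s2 / (real n * \<eta>)) \<le> \<upsilon> * (\<kappa> * s2 / (real n * \<eta>))"
        using \<upsilon> \<kappa>_pos s2_pos pos[OF \<eta>] by (intro mult_right_mono) auto
      also have "\<dots> = 8 * (V \<eta> / (8 * k1\<^sup>2))" using k by (simp add: V_def GL_V_eq)
      finally have "18 * (\<kappa> * s2 / (real n * \<eta>)) \<le> V \<eta> / (8 * k1\<^sup>2)" by simp
      then show "max 0 (nsq lborel (\<lambda>x. est {1..n} (\<lambda>i. X i \<omega>) (\<lambda>i. Y i \<omega> / real n) \<eta> x
          - fconv (scaled K \<eta>) g x) - V \<eta> / (8 * k1\<^sup>2)) \<le> W \<omega> \<eta>"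
        by (simp add: W_def bf_hat_eq_est)
    qed
    then have "(48 * k1\<^sup>2 + 6) * orc.excess \<le> (48 * k1\<^sup>2 + 6) * (\<Sum>\<eta>\<in>H. W \<omega> \<eta>)"
      by (rule mult_left_mono) simp
    moreover have "(12 * k1\<^sup>2 + 6) * orc.bias h + 12 * V h \<le> (12 * k1\<^sup>2 + 12) * r h"
    proof -
      have "(12 * k1\<^sup>2 + 6) * orc.bias h \<le> (12 * k1\<^sup>2 + 12) * orc.bias h"
        by (intro mult_right_mono) (simp_all add: orc.bias_def nsq_nonneg)
      moreover have "12 * V h \<le> (12 * k1\<^sup>2 + 12) * V h"
        using V[OF h] by (intro mult_right_mono) simp_all
      ultimately show ?thesis by (simp add: r_def orc.bias_def distrib_left)
    qed
    ultimately show ?thesis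
      using orc.oracle_inequality[OF h] by (simp add: Lp_norm_2_power2 bf_hat_eq_est)
  qed
  have r0: "0 \<le> r h" using V[OF h] by (simp add: r_def nsq_nonneg)
  have W0: "0 \<le> W \<omega> \<eta>" for \<omega> \<eta> by (simp add: W_def)
  have E0: "0 \<le> excess_bound n \<eta>" if "\<eta> \<in> H" for \<eta>
    using pos[OF that] \<kappa>_pos s2_pos s4_nonneg by (simp add: excess_bound_def)
  have "(\<integral>\<^sup>+\<omega>. ennreal ((Lp_norm 2 (\<lambda>x. bf_hat K X Y n (hhat \<omega>) \<omega> x - g x))\<^sup>2) \<partial>M)
      \<le> (\<integral>\<^sup>+\<omega>. ennreal ((12 * k1\<^sup>2 + 12) * r h) + ennreal (48 * k1\<^sup>2 + 6) * (\<Sum>\<eta>\<in>H. ennreal (W \<omega> \<eta>)) \<partial>M)"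
    using risk r0 W0 by (intro nn_integral_mono)
      (simp add: sum_nonneg ennreal_leI flip: ennreal_mult ennreal_plus)
  also have "\<dots> = ennreal ((12 * k1\<^sup>2 + 12) * r h) + ennreal (48 * k1\<^sup>2 + 6) * (\<Sum>\<eta>\<in>H. \<integral>\<^sup>+\<omega>. ennreal (W \<omega> \<eta>) \<partial>M)"
    using W_meas by (simp add: nn_integral_add nn_integral_cmult nn_integral_sum emeasure_space_1)
  also have "\<dots> \<le> ennreal ((12 * k1\<^sup>2 + 12) * r h) + ennreal (48 * k1\<^sup>2 + 6) * (\<Sum>\<eta>\<in>H. ennreal (excess_bound n \<eta>))"
    using nn_integral_excess_le[OF n pos]
    by (intro add_left_mono mult_left_mono sum_mono) (simp_all add: W_def g_def)
  also have "\<dots> = ennreal ((12 * k1\<^sup>2 + 12) * r h + (48 * k1\<^sup>2 + 6) * (\<Sum>\<eta>\<in>H. excess_bound n \<eta>))"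
    using r0 E0 by (simp add: sum_nonneg flip: ennreal_mult ennreal_plus)
  finally show ?thesis
    unfolding r_h[symmetric] by (simp add: r_def V_def g_def Lp_norm_2_power2)
qed

end

text \<open>The penalty constant has to be large enough, and the bound 144 on it precedes all
  quantifiers over models and kernels. The constants of the risk bound depend on the model, the
  kernel and the two bandwidth bounds. Sample sizes start at 2 because
  \<open>1 / n < h \<le> 1\<close> admits no bandwidth for \<open>n = 1\<close>.\<close>

theorem theorem3p2:
  shows "\<exists>\<upsilon>\<^sub>0>0. \<forall>\<upsilon>\<ge>\<upsilon>\<^sub>0.
    \<forall>(M :: 'a measure) (X :: nat \<Rightarrow> 'a \<Rightarrow> real) (\<epsilon> :: nat \<Rightarrow> 'a \<Rightarrow> real)
      (b :: real \<Rightarrow> real) (f :: real \<Rightarrow> real) (\<sigma> :: real) (K :: real \<Rightarrow> real)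
      (H :: nat \<Rightarrow> real set).
    (let Y = response b X \<epsilon>; bf = (\<lambda>x. b x * f x) in
      regression_model M X \<epsilon> b f \<sigma>
      \<and> K \<in> borel_measurable borel
      \<and> bounded (range K)
      \<and> integrable lborel (\<lambda>x. (K x)\<^sup>2)
      \<and> integrable lborel K
      \<and> (\<integral>y. K y \<partial>lborel) = 1
      \<and> (\<forall>x. K (- x) = K x)
      \<and> bounded (range f)
      \<and> (\<forall>n\<ge>2. bandwidths n (H n))
      \<and> (\<exists>m>0. \<forall>n\<ge>2. 1 / real n * (\<Sum>h\<in>H n. 1 / h) \<le> m)
      \<and> (\<forall>c>0. \<exists>m>0. \<forall>n\<ge>2. (\<Sum>h\<in>H n. 1 / sqrt h * exp (- c / sqrt h)) \<le> m)
      \<and> integrable M (\<lambda>\<omega>. (Y 1 \<omega>) ^ 6)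
      \<longrightarrow>
      (\<exists>c>0. \<exists>c'>0. \<forall>n\<ge>2. \<forall>hhat. GL_selection M K X Y \<upsilon> n (H n) hhat \<longrightarrow>
        (\<integral>\<^sup>+\<omega>. ennreal ((Lp_norm 2 (\<lambda>x. bf_hat K X Y n (hhat \<omega>) \<omega> x - bf x))\<^sup>2) \<partial>M)
        \<le> ennreal (c * (INF h\<in>H n. (Lp_norm 2 (\<lambda>x. fconv (scaled K h) bf x - bf x))\<^sup>2
                                   + GL_V M K Y \<upsilon> n h)
                   + c' * ((ln (real n))\<^sup>2 / real n))))"
proof (intro exI[of _ "144 :: real"] conjI allI impI, goal_cases)
  case 1
  show ?case by simp
next
  case (2 \<upsilon> M X \<epsilon> b f \<sigma> K H)
  note \<upsilon> = \<open>144 \<le> \<upsilon>\<close>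
  show ?case
    unfolding Let_def
  proof (rule impI, elim conjE)
    assume model: "regression_model M X \<epsilon> b f \<sigma>"
      and K: "bounded (range K)" "integrable lborel (\<lambda>x. (K x)\<^sup>2)" "integrable lborel K"
        "(\<integral>y. K y \<partial>lborel) = 1" "\<forall>x. K (- x) = K x"
      and f: "bounded (range f)"
      and H: "\<forall>n\<ge>2. bandwidths n (H n)"
      and H1: "\<exists>m>0. \<forall>n\<ge>2. 1 / real n * (\<Sum>h\<in>H n. 1 / h) \<le> m"
      and H2: "\<forall>c>0. \<exists>m>0. \<forall>n\<ge>2. (\<Sum>h\<in>H n. 1 / sqrt h * exp (- c / sqrt h)) \<le> m"
      and Y6: "integrable M (\<lambda>\<omega>. (response b X \<epsilon> 1 \<omega>) ^ 6)"
    obtain fb where fb: "0 < fb" "\<And>x. \<bar>f x\<bar> \<le> fb"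
      using f unfolding bounded_pos by auto
    have fb': "f x \<le> fb" for x using fb(2)[of x] by simp
    interpret regression_model M X \<epsilon> b f \<sigma> by (rule model)
    interpret kernel_regression M X \<epsilon> b f \<sigma> K fb
      by unfold_locales (use K fb fb' Y6 in auto)
    obtain mH where mH: "0 < mH" "\<And>n. 2 \<le> n \<Longrightarrow> 1 / real n * (\<Sum>h\<in>H n. 1 / h) \<le> mH"
      using H1 by auto
    \<comment> \<open>The second bandwidth condition is used at this one constant, the rate of the
      Gaussian regime, which is free of \<open>n\<close>.\<close>
    have "0 < \<kappa> * s2 / (32 * v0)" using \<kappa>_pos s2_pos v0_pos by simp
    then obtain m0 where m0: "0 < m0"
      "\<And>n. 2 \<le> n \<Longrightarrow> (\<Sum>h\<in>H n. 1 / sqrt h * exp (- (\<kappa> * s2 / (32 * v0)) / sqrt h)) \<le> m0"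
      using H2 by blast
    define D where "D = 6912 * v0\<^sup>2 / (\<kappa> * s2) * m0 / (ln 2)\<^sup>2 + 27 / 4 * (\<kappa> * s2) * mH / (ln 2) ^ 4
        + 512 * \<kappa> * s4 / s2 * mH"
    have D: "0 < D"
      unfolding D_def using \<kappa>_pos s2_pos v0_pos m0(1) mH(1) s4_nonneg
      by (intro add_pos_nonneg add_pos_pos) simp_all
    show "\<exists>c>0. \<exists>c'>0. \<forall>n\<ge>2. \<forall>hhat. GL_selection M K X (response b X \<epsilon>) \<upsilon> n (H n) hhat \<longrightarrow>
        (\<integral>\<^sup>+\<omega>. ennreal ((Lp_norm 2 (\<lambda>x. bf_hat K X (response b X \<epsilon>) n (hhat \<omega>) \<omega> x - b x * f x))\<^sup>2) \<partial>M)
        \<le> ennreal (c * (INF h\<in>H n. (Lp_norm 2 (\<lambda>x. fconv (scaled K h) (\<lambda>x. b x * f x) x - b x * f x))\<^sup>2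
                                   + GL_V M K (response b X \<epsilon>) \<upsilon> n h)
                   + c' * ((ln (real n))\<^sup>2 / real n))"
    proof (rule exI[of _ "12 * k1\<^sup>2 + 12"], intro exI[of _ "(48 * k1\<^sup>2 + 6) * D"] conjI allI impI)
      show "0 < 12 * k1\<^sup>2 + 12" "0 < (48 * k1\<^sup>2 + 6) * D"
        using D by (simp_all add: add_nonneg_pos)
      fix n :: nat and hhat
      assume n: "2 \<le> n" and sel: "GL_selection M K X Y \<upsilon> n (H n) hhat"
      have Hn: "bandwidths n (H n)" using H n by simp
      have bw: "0 < h" "h \<le> 1" if "h \<in> H n" for h
      proof -
        have "1 / real n < h" using Hn that by (simp add: bandwidths_def)
        moreover have "0 \<le> 1 / real n" by simp
        ultimately show "0 < h" by linarith
        show "h \<le> 1" using Hn that by (auto simp: bandwidths_def)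
      qed
      have "(\<Sum>h\<in>H n. excess_bound n h) \<le> D * ((ln (real n))\<^sup>2 / real n)"
        unfolding D_def by (rule sum_excess_bound_le[OF n bw mH(2)[OF n] m0(2)[OF n]])
      then have "(48 * k1\<^sup>2 + 6) * (\<Sum>h\<in>H n. excess_bound n h)
          \<le> (48 * k1\<^sup>2 + 6) * D * ((ln (real n))\<^sup>2 / real n)"
        unfolding mult.assoc by (rule mult_left_mono) simp
      then show "(\<integral>\<^sup>+\<omega>. ennreal ((Lp_norm 2 (\<lambda>x. bf_hat K X Y n (hhat \<omega>) \<omega> x - b x * f x))\<^sup>2) \<partial>M)
        \<le> ennreal ((12 * k1\<^sup>2 + 12) * (INF h\<in>H n. (Lp_norm 2 (\<lambda>x. fconv (scaled K h) (\<lambda>x. b x * f x) x - b x * f x))\<^sup>2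
            + GL_V M K Y \<upsilon> n h) + (48 * k1\<^sup>2 + 6) * D * ((ln (real n))\<^sup>2 / real n))"
        by (intro order_trans[OF GL_risk_le[OF n Hn \<upsilon> sel]] ennreal_leI add_left_mono)
    qed
  qed
qed

end
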